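(* Let $\Omega\subset\mathbb{R}^2$ be a bounded polygonal domain. Let $\alpha_\epsilon:\Omega\to\mathbb{R}$ be measurable and suppose there are constants $\alpha_0,\alpha_1$ with $0<\alpha_0\le\alpha_\epsilon(x)\le\alpha_1$ for almost every $x\in\Omega$. Let $b:\mathbb{R}\to\mathbb{R}$ be continuous, with $b\in W^{2,\infty}(\mathbb{R})$, and suppose there is a constant $b_0$ with $0<b_0\le b(t)$ for all $t\in\mathbb{R}$. Then, for every $f\in L^2(\Omega)$, there exists one and only one $u_\epsilon\in H^1_0(\Omega)$ such that $$\int_\Omega\alpha_\epsilon(x)\,b(u_\epsilon)\,\nabla u_\epsilon\cdot\nabla v\,dx=\int_\Omega f v\,dx\qquad\text{for all }v\in H^1_0(\Omega).$$
   Context: $H^1_0(\Omega)$ is the usual Sobolev space with zero trace; $W^{2,\infty}(\mathbb{R})$ is the usual Sobolev space (so $b$, $b'$, $b''$ are essentially bounded). The subscript $\epsilon$ is a fixed parameter labelling the (possibly oscillatory) coefficient. *)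

theory Defs
  imports "HOL-Analysis.Analysis"
begin

text \<open>Functions on a domain \<open>\<Omega>\<close> are total functions of which only the values on \<open>\<Omega>\<close>
  are used; the elements of the function spaces below are functions rather than classes of
  almost everywhere equal functions, so uniqueness has to be read almost everywhere.\<close>

definition polygonal_domain :: "(real^2) set \<Rightarrow> bool" where
  "polygonal_domain \<Omega> \<longleftrightarrow>
     open \<Omega> \<and> connected \<Omega> \<and> \<Omega> \<noteq> {} \<and>
     (\<exists>S. finite S \<and> (\<forall>(p, q)\<in>S. p \<noteq> q) \<and> frontier \<Omega> = (\<Union>(p, q)\<in>S. closed_segment p q))"

definition partial :: "'a::euclidean_space \<Rightarrow> ('a \<Rightarrow> real) \<Rightarrow> 'a \<Rightarrow> real" where
  "partial i \<phi> x = frechet_derivative \<phi> (at x) i"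

primrec Ck :: "nat \<Rightarrow> ('a::euclidean_space \<Rightarrow> real) \<Rightarrow> bool" where
  "Ck 0 \<phi> \<longleftrightarrow> continuous_on UNIV \<phi>"
| "Ck (Suc k) \<phi> \<longleftrightarrow> (\<forall>x. \<phi> differentiable at x) \<and> (\<forall>i\<in>Basis. Ck k (partial i \<phi>))"

definition test_fun :: "'a::euclidean_space set \<Rightarrow> ('a \<Rightarrow> real) \<Rightarrow> bool" where
  "test_fun \<Omega> \<phi> \<longleftrightarrow>
     (\<forall>k. Ck k \<phi>) \<and> compact (closure {x. \<phi> x \<noteq> 0}) \<and> closure {x. \<phi> x \<noteq> 0} \<subseteq> \<Omega>"

definition locally_integrable :: "'a::euclidean_space set \<Rightarrow> ('a \<Rightarrow> real) \<Rightarrow> bool" where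
  "locally_integrable \<Omega> u \<longleftrightarrow> (\<forall>K. compact K \<and> K \<subseteq> \<Omega> \<longrightarrow> u absolutely_integrable_on K)"

definition has_weak_partial ::
    "'a::euclidean_space set \<Rightarrow> 'a \<Rightarrow> ('a \<Rightarrow> real) \<Rightarrow> ('a \<Rightarrow> real) \<Rightarrow> bool" where
  "has_weak_partial \<Omega> i u g \<longleftrightarrow>
     locally_integrable \<Omega> u \<and> locally_integrable \<Omega> g \<and>
     (\<forall>\<phi>. test_fun \<Omega> \<phi> \<longrightarrow>
        (LINT x|lebesgue_on \<Omega>. u x * partial i \<phi> x) = - (LINT x|lebesgue_on \<Omega>. g x * \<phi> x))"

text \<open>Weak partial derivatives are determined only almost everywhere; the following picks a
  representative, and is meaningful only if a weak partial derivative exists.\<close>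

definition weak_partial :: "'a::euclidean_space set \<Rightarrow> 'a \<Rightarrow> ('a \<Rightarrow> real) \<Rightarrow> 'a \<Rightarrow> real" where
  "weak_partial \<Omega> i u = (SOME g. has_weak_partial \<Omega> i u g)"

definition weak_grad :: "'a::euclidean_space set \<Rightarrow> ('a \<Rightarrow> real) \<Rightarrow> 'a \<Rightarrow> 'a" where
  "weak_grad \<Omega> u x = (\<Sum>i\<in>Basis. weak_partial \<Omega> i u x *\<^sub>R i)"

definition L2 :: "'a::euclidean_space set \<Rightarrow> ('a \<Rightarrow> real) set" where
  "L2 \<Omega> = {u \<in> borel_measurable (lebesgue_on \<Omega>). integrable (lebesgue_on \<Omega>) (\<lambda>x. (u x)\<^sup>2)}"

definition Linf :: "'a::euclidean_space set \<Rightarrow> ('a \<Rightarrow> real) set" where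
  "Linf \<Omega> = {u \<in> borel_measurable (lebesgue_on \<Omega>). \<exists>C. AE x in lebesgue_on \<Omega>. \<bar>u x\<bar> \<le> C}"

definition W2inf :: "'a::euclidean_space set \<Rightarrow> ('a \<Rightarrow> real) set" where
  "W2inf \<Omega> = {u \<in> Linf \<Omega>. \<forall>i\<in>Basis. \<exists>g\<in>Linf \<Omega>. has_weak_partial \<Omega> i u g \<and>
                 (\<forall>j\<in>Basis. \<exists>h\<in>Linf \<Omega>. has_weak_partial \<Omega> j g h)}"

definition H1 :: "'a::euclidean_space set \<Rightarrow> ('a \<Rightarrow> real) set" where
  "H1 \<Omega> = {u \<in> L2 \<Omega>. \<forall>i\<in>Basis. \<exists>g\<in>L2 \<Omega>. has_weak_partial \<Omega> i u g}"

definition H1_norm :: "'a::euclidean_space set \<Rightarrow> ('a \<Rightarrow> real) \<Rightarrow> real" where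
  "H1_norm \<Omega> u =
     sqrt ((LINT x|lebesgue_on \<Omega>. (u x)\<^sup>2) + (LINT x|lebesgue_on \<Omega>. (norm (weak_grad \<Omega> u x))\<^sup>2))"

text \<open>Zero boundary values are expressed, as usual, by taking the closure of the test functions
  in the \<open>H1\<close> norm.\<close>

definition H10 :: "'a::euclidean_space set \<Rightarrow> ('a \<Rightarrow> real) set" where
  "H10 \<Omega> = {u \<in> H1 \<Omega>. \<exists>\<phi>. (\<forall>n. test_fun \<Omega> (\<phi> n)) \<and>
               (\<lambda>n::nat. H1_norm \<Omega> (\<lambda>x. \<phi> n x - u x)) \<longlonglongrightarrow> 0}"

definition weak_solution ::
    "(real^2) set \<Rightarrow> (real^2 \<Rightarrow> real) \<Rightarrow> (real \<Rightarrow> real) \<Rightarrow> (real^2 \<Rightarrow> real) \<Rightarrow> (real^2 \<Rightarrow> real) \<Rightarrow> bool"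
  where
  "weak_solution \<Omega> \<alpha> b f u \<longleftrightarrow> u \<in> H10 \<Omega> \<and>
     (\<forall>v\<in>H10 \<Omega>.
        (LINT x|lebesgue_on \<Omega>. \<alpha> x * b (u x) * (weak_grad \<Omega> u x \<bullet> weak_grad \<Omega> v x))
        = (LINT x|lebesgue_on \<Omega>. f x * v x))"

end

theory Submission
  imports Defs
begin

text \<open>Let \<open>B\<close> be the antiderivative of \<open>b\<close> with \<open>B 0 = 0\<close>. Since \<open>b\<close> is continuous and takes values in
  a compact subinterval of \<open>(0, \<infinity>)\<close>, the Kirchhoff transform \<open>w = B(u)\<close> is a bijection of
  \<open>H\<^sup>1\<^sub>0(\<Omega>)\<close> with \<open>\<nabla>w = b(u) \<nabla>u\<close>. Hence \<open>u\<close> solves the quasilinear problem if and only if \<open>w\<close>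
  solves the linear problem with coefficient \<open>\<alpha>\<close>, which is symmetric and coercive by the Poincare
  inequality and is solved by minimising its energy. The chain rule for \<open>B\<close> and its inverse, which are only
  \<open>C\<^sup>1\<close>, needs no mollification: on the range of a test function \<open>\<phi>\<close>, the derivative is
  approximated uniformly by polynomials, and a polynomial without constant term maps \<open>\<phi>\<close> to a test
  function.\<close>

section \<open>Square integrable functions\<close>

text \<open>With the coefficient \<open>b(u)\<close> the form is in general neither symmetric nor
  monotone in \<open>u\<close>, so neither minimising an energy nor subtracting two solutions works
  on the original equation. The transform moves the nonlinearity into the unknown, where injectivity
  of \<open>B\<close> undoes it, and uniqueness of \<open>u\<close> is inherited from the linear
  problem. A second obstacle is that the spaces consist of functions, not of classes, and that
  \<open>weak_grad\<close> is a chosen representative. Hence no Hilbert space is formed: the energy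
  is minimised over test functions only, the limits of the values and of the gradients are taken
  separately in L2, and the two limits are kept together as a pair. In the chain rule the derivative
  is what gets approximated, and the approximation is integrated from 0. One estimate then controls
  values and gradients alike, whereas a uniform approximation of the function would say nothing
  about its derivative.\<close>

definition square_integrable :: "'a measure \<Rightarrow> ('a \<Rightarrow> 'b::euclidean_space) \<Rightarrow> bool" where
  "square_integrable M f \<longleftrightarrow> f \<in> borel_measurable M \<and> integrable M (\<lambda>x. (norm (f x))\<^sup>2)"

lemma square_integrable_measurable [measurable_dest]:
  "square_integrable M f \<Longrightarrow> f \<in> borel_measurable M"
  by (simp add: square_integrable_def)

lemma square_integrableD:
  "square_integrable M f \<Longrightarrow> integrable M (\<lambda>x. (norm (f x))\<^sup>2)"
  by (simp add: square_integrable_def)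

lemma square_integrable_bound:
  assumes "square_integrable M f" and [measurable]: "g \<in> borel_measurable M"
    and "AE x in M. norm (g x) \<le> C * norm (f x)"
  shows "square_integrable M g"
proof -
  have "integrable M (\<lambda>x. C\<^sup>2 * (norm (f x))\<^sup>2)"
    using assms(1) by (intro integrable_mult_right) (rule square_integrableD)
  moreover have "(\<lambda>x. (norm (g x))\<^sup>2) \<in> borel_measurable M" by measurable
  moreover have "AE x in M. norm ((norm (g x))\<^sup>2) \<le> norm (C\<^sup>2 * (norm (f x))\<^sup>2)"
    using assms(3)
  proof eventually_elim
    case (elim x)
    then have "(norm (g x))\<^sup>2 \<le> (C * norm (f x))\<^sup>2"
      by (intro power_mono) auto
    then show ?case by (simp add: power_mult_distrib)
  qed
  ultimately have "integrable M (\<lambda>x. (norm (g x))\<^sup>2)"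
    by (rule Bochner_Integration.integrable_bound)
  then show ?thesis by (simp add: square_integrable_def)
qed

text \<open>The two sides differ by exactly the square of \<open>norm (a - b)\<close>. Pointwise use
  of this bound under the integral takes the place of the triangle inequality in L2.\<close>

lemma norm_add_sq_le: "(norm (a + b :: 'a::real_inner))\<^sup>2 \<le> 2 * (norm a)\<^sup>2 + 2 * (norm b)\<^sup>2"
proof -
  have "0 \<le> (norm (a - b))\<^sup>2" by simp
  then show ?thesis by (simp add: power2_norm_eq_inner inner_simps inner_commute)
qed

lemma square_integrable_add:
  assumes "square_integrable M f" "square_integrable M g"
  shows "square_integrable M (\<lambda>x. f x + g x)"
proof -
  note [measurable] = assms[THEN square_integrable_measurable]
  have "integrable M (\<lambda>x. 2 * (norm (f x))\<^sup>2 + 2 * (norm (g x))\<^sup>2)"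
    using assms by (intro Bochner_Integration.integrable_add integrable_mult_right square_integrableD)
  then have "integrable M (\<lambda>x. (norm (f x + g x))\<^sup>2)"
    by (rule Bochner_Integration.integrable_bound) (auto intro!: AE_I2 norm_add_sq_le)
  then show ?thesis by (simp add: square_integrable_def)
qed

lemma square_integrable_scaleR:
  "square_integrable M f \<Longrightarrow> square_integrable M (\<lambda>x. c *\<^sub>R f x)"
  by (rule square_integrable_bound[where C="\<bar>c\<bar>" and f=f])
    (auto intro: borel_measurable_scaleR square_integrable_measurable)

lemma square_integrable_diff:
  "square_integrable M f \<Longrightarrow> square_integrable M g \<Longrightarrow> square_integrable M (\<lambda>x. f x - g x)"
  using square_integrable_add[of M f "\<lambda>x. (-1) *\<^sub>R g x"] square_integrable_scaleR[of M g "-1"] by simp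

lemma square_integrable_AE:
  assumes "square_integrable M f" "g \<in> borel_measurable M" "AE x in M. f x = g x"
  shows "square_integrable M g"
  by (rule square_integrable_bound[OF assms(1,2), where C=1]) (use assms(3) in \<open>eventually_elim, simp\<close>)

lemma square_integrable_mult_bounded:
  assumes "square_integrable M f" and [measurable]: "a \<in> borel_measurable M"
    and "AE x in M. \<bar>a x\<bar> \<le> C"
  shows "square_integrable M (\<lambda>x. a x *\<^sub>R f x)"
proof (rule square_integrable_bound[OF assms(1), where C=C])
  show "(\<lambda>x. a x *\<^sub>R f x) \<in> borel_measurable M"
    using assms(1) by measurable
  show "AE x in M. norm (a x *\<^sub>R f x) \<le> C * norm (f x)"
    using assms(3) by eventually_elim (auto intro!: mult_right_mono)
qed

lemma integrable_norm_mult: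
  assumes "square_integrable M f" "square_integrable M g"
  shows "integrable M (\<lambda>x. norm (f x) * norm (g x))"
proof -
  note [measurable] = assms[THEN square_integrable_measurable]
  have "integrable M (\<lambda>x. (norm (f x))\<^sup>2 + (norm (g x))\<^sup>2)"
    using assms by (intro Bochner_Integration.integrable_add square_integrableD)
  then show ?thesis
  proof (rule Bochner_Integration.integrable_bound)
    show "AE x in M. norm (norm (f x) * norm (g x)) \<le> norm ((norm (f x))\<^sup>2 + (norm (g x))\<^sup>2)"
    proof (rule AE_I2)
      fix x
      have "2 * norm (f x) * norm (g x) \<le> (norm (f x))\<^sup>2 + (norm (g x))\<^sup>2"
        by (rule sum_squares_bound)
      moreover have "0 \<le> norm (f x) * norm (g x)" by (rule mult_nonneg_nonneg) auto
      ultimately have "norm (f x) * norm (g x) \<le> (norm (f x))\<^sup>2 + (norm (g x))\<^sup>2"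
        unfolding mult.assoc by linarith
      then show "norm (norm (f x) * norm (g x)) \<le> norm ((norm (f x))\<^sup>2 + (norm (g x))\<^sup>2)"
        by simp
    qed
  qed measurable
qed

lemma integrable_inner_square_integrable:
  assumes "square_integrable M f" "square_integrable M g"
  shows "integrable M (\<lambda>x. f x \<bullet> g x)"
proof -
  note [measurable] = assms[THEN square_integrable_measurable]
  show ?thesis
    by (rule Bochner_Integration.integrable_bound[OF integrable_norm_mult[OF assms]])
      (auto intro!: AE_I2 simp: Cauchy_Schwarz_ineq2)
qed

lemma integrable_mult_square_integrable:
  fixes f g :: "'a \<Rightarrow> real"
  assumes "square_integrable M f" "square_integrable M g"
  shows "integrable M (\<lambda>x. f x * g x)"
  using integrable_inner_square_integrable[OF assms] by simp

lemma square_integrable_const: "finite_measure M \<Longrightarrow> square_integrable M (\<lambda>_. c)"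
  by (simp add: square_integrable_def finite_measure.integrable_const)

lemma square_integrable_bounded:
  assumes "finite_measure M" "f \<in> borel_measurable M" "AE x in M. norm (f x) \<le> C"
  shows "square_integrable M f"
  by (rule square_integrable_bound[OF square_integrable_const[OF assms(1), where c="1::real"] assms(2), where C=C])
    (use assms(3) in simp)

section \<open>Cauchy-Schwarz, convergence and completeness in L2\<close>

lemma Cauchy_Schwarz_integral:
  assumes "square_integrable M f" "square_integrable M g"
  shows "(LINT x|M. f x \<bullet> g x)\<^sup>2 \<le> (LINT x|M. (norm (f x))\<^sup>2) * (LINT x|M. (norm (g x))\<^sup>2)"
proof -
  note [measurable] = assms[THEN square_integrable_measurable]
  have f: "(\<integral>\<^sup>+x. (ennreal (norm (f x)))\<^sup>2 \<partial>M) = ennreal (LINT x|M. (norm (f x))\<^sup>2)"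
    if "square_integrable M f" for f
    using nn_integral_eq_integral[OF square_integrableD[OF that]]
    by (simp add: ennreal_power)
  have "(\<integral>\<^sup>+x. ennreal (norm (f x)) * ennreal (norm (g x)) \<partial>M) = ennreal (LINT x|M. norm (f x) * norm (g x))"
    using nn_integral_eq_integral[OF integrable_norm_mult[OF assms]]
    by (simp add: ennreal_mult)
  with Cauchy_Schwarz_nn_integral[of "\<lambda>x. ennreal (norm (f x))" M "\<lambda>x. ennreal (norm (g x))"]
  have "ennreal ((LINT x|M. norm (f x) * norm (g x))\<^sup>2)
      \<le> ennreal ((LINT x|M. (norm (f x))\<^sup>2) * (LINT x|M. (norm (g x))\<^sup>2))"
    unfolding f[OF assms(1)] f[OF assms(2)]
    by (simp add: ennreal_power integral_nonneg_AE ennreal_mult)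
  then have *: "(LINT x|M. norm (f x) * norm (g x))\<^sup>2 \<le> (LINT x|M. (norm (f x))\<^sup>2) * (LINT x|M. (norm (g x))\<^sup>2)"
    by (simp add: ennreal_le_iff)
  have "\<bar>LINT x|M. f x \<bullet> g x\<bar> \<le> (LINT x|M. \<bar>f x \<bullet> g x\<bar>)"
    by (rule integral_abs_bound)
  also have "\<dots> \<le> (LINT x|M. norm (f x) * norm (g x))"
    using assms by (intro integral_mono integrable_abs integrable_inner_square_integrable integrable_norm_mult)
      (auto simp: Cauchy_Schwarz_ineq2)
  finally have "\<bar>LINT x|M. f x \<bullet> g x\<bar>\<^sup>2 \<le> (LINT x|M. norm (f x) * norm (g x))\<^sup>2"
    by (intro power_mono) auto
  with * show ?thesis by simp
qed

text \<open>Strong convergence in L2 implies weak convergence, by Cauchy-Schwarz. Every later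
  passage to the limit in a linear identity rests on this.\<close>

lemma tendsto_integral_inner:
  assumes f: "square_integrable M f" and g: "\<And>n. square_integrable M (g n)" "square_integrable M h"
    and lim: "(\<lambda>n. LINT x|M. (norm (g n x - h x))\<^sup>2) \<longlonglongrightarrow> 0"
  shows "(\<lambda>n. LINT x|M. f x \<bullet> g n x) \<longlonglongrightarrow> (LINT x|M. f x \<bullet> h x)"
proof -
  have "(\<lambda>n. (LINT x|M. f x \<bullet> (g n x - h x))\<^sup>2) \<longlonglongrightarrow> 0"
  proof (rule tendsto_sandwich[OF _ _ tendsto_const])
    show "\<forall>\<^sub>F n in sequentially. (LINT x|M. f x \<bullet> (g n x - h x))\<^sup>2
        \<le> (LINT x|M. (norm (f x))\<^sup>2) * (LINT x|M. (norm (g n x - h x))\<^sup>2)"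
      by (intro always_eventually allI Cauchy_Schwarz_integral f square_integrable_diff g)
    show "(\<lambda>n. (LINT x|M. (norm (f x))\<^sup>2) * (LINT x|M. (norm (g n x - h x))\<^sup>2)) \<longlonglongrightarrow> 0"
      using tendsto_mult_right_zero[OF lim] by simp
  qed auto
  then have "(\<lambda>n. LINT x|M. f x \<bullet> (g n x - h x)) \<longlonglongrightarrow> 0"
    by (simp add: power_tendsto_0_iff)
  then have "(\<lambda>n. (LINT x|M. f x \<bullet> g n x) - (LINT x|M. f x \<bullet> h x)) \<longlonglongrightarrow> 0"
    by (simp add: inner_diff_right Bochner_Integration.integral_diff
        integrable_inner_square_integrable f g)
  then show ?thesis by (simp add: LIM_zero_iff)
qed

lemma square_integrable_tendsto_subseq_AE:
  assumes g: "\<And>n. square_integrable M (g n)" "square_integrable M h"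
    and lim: "(\<lambda>n. LINT x|M. (norm (g n x - h x))\<^sup>2) \<longlonglongrightarrow> 0"
  obtains r :: "nat \<Rightarrow> nat" where "strict_mono r" "AE x in M. (\<lambda>n. g (r n) x) \<longlonglongrightarrow> h x"
proof -
  have "\<exists>r::nat\<Rightarrow>nat. strict_mono r \<and> (AE x in M. (\<lambda>n. (norm (g (r n) x - h x))\<^sup>2) \<longlonglongrightarrow> 0)"
    using lim by (intro tendsto_L1_AE_subseq[where u="\<lambda>n x. (norm (g n x - h x))\<^sup>2"])
      (auto intro!: square_integrableD square_integrable_diff g)
  then obtain r :: "nat \<Rightarrow> nat" where r: "strict_mono r" "AE x in M. (\<lambda>n. (norm (g (r n) x - h x))\<^sup>2) \<longlonglongrightarrow> 0"
    by blast
  from r(2) have "AE x in M. (\<lambda>n. g (r n) x) \<longlonglongrightarrow> h x"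
    by eventually_elim (simp add: power_tendsto_0_iff tendsto_norm_zero_iff LIM_zero_iff)
  with r(1) show ?thesis by (rule that)
qed

text \<open>Riesz--Fischer. The elementary inequality \<open>d \<le> 2\<^sup>-\<^sup>k + 2\<^sup>k d\<^sup>2\<close> turns the rapid
  \<open>L\<^sup>2\<close> decay of the increments of a subsequence into absolute summability almost everywhere.\<close>

theorem square_integrable_complete:
  fixes f :: "nat \<Rightarrow> 'a \<Rightarrow> 'b::euclidean_space"
  assumes f: "\<And>n. square_integrable M (f n)"
    and Cauchy: "\<And>e. e > 0 \<Longrightarrow> \<exists>N. \<forall>m\<ge>N. \<forall>n\<ge>N. (LINT x|M. (norm (f m x - f n x))\<^sup>2) \<le> e"
  obtains h where "square_integrable M h" "(\<lambda>n. LINT x|M. (norm (f n x - h x))\<^sup>2) \<longlonglongrightarrow> 0"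
proof -
  note [measurable] = f[THEN square_integrable_measurable]
  have eq: "(\<integral>\<^sup>+x. ennreal ((norm (f m x - f n x))\<^sup>2) \<partial>M) = ennreal (LINT x|M. (norm (f m x - f n x))\<^sup>2)" for m n
    by (intro nn_integral_eq_integral square_integrableD square_integrable_diff f) auto
  \<comment> \<open>The rate \<open>(1/4)^k\<close> is chosen so that the weight \<open>2^k\<close>
    still leaves the summable bound \<open>(1/2)^k\<close>.\<close>
  define N where "N k = (SOME N. \<forall>m\<ge>N. \<forall>n\<ge>N. (LINT x|M. (norm (f m x - f n x))\<^sup>2) \<le> (1/4)^k)" for k
  have N: "(LINT x|M. (norm (f m x - f n x))\<^sup>2) \<le> (1/4)^k" if "m \<ge> N k" "n \<ge> N k" for m n k
    using someI_ex[OF Cauchy[of "(1/4)^k"], folded N_def] that by auto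
  \<comment> \<open>Adding \<open>k\<close> to a partial sum of the \<open>N j\<close> makes
    \<open>r\<close> increasing and at least as large as both \<open>k\<close> and
    \<open>N k\<close>.\<close>
  define r where "r k = k + (\<Sum>j\<le>k. N j)" for k
  have rN: "N k \<le> r k" for k
    unfolding r_def by (intro trans_le_add2 member_le_sum) auto
  have rk: "r k \<ge> k" for k unfolding r_def by simp
  have rS: "r k \<le> r (Suc k)" for k unfolding r_def by simp
  define d where "d k x = norm (f (r (Suc k)) x - f (r k) x)" for k x
  have [measurable]: "d k \<in> borel_measurable M" for k unfolding d_def by measurable
  have int_d: "(\<integral>\<^sup>+x. ennreal ((2^k) * (d k x)\<^sup>2) \<partial>M) \<le> ennreal ((1/2)^k)" for k
  proof -
    have "(\<integral>\<^sup>+x. ennreal ((2^k) * (d k x)\<^sup>2) \<partial>M) = ennreal (2^k) * (\<integral>\<^sup>+x. ennreal ((d k x)\<^sup>2) \<partial>M)"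
      by (simp add: ennreal_mult nn_integral_cmult)
    also have "\<dots> \<le> ennreal (2^k) * ennreal ((1/4)^k)"
      unfolding d_def eq using rN[of k] rS[of k] by (intro mult_left_mono ennreal_leI N) auto
    also have "\<dots> = ennreal ((1/2)^k)"
      by (simp add: ennreal_mult[symmetric] power_mult_distrib[symmetric])
    finally show ?thesis .
  qed
  have "(\<integral>\<^sup>+x. (\<Sum>k. ennreal ((2^k) * (d k x)\<^sup>2)) \<partial>M) = (\<Sum>k. \<integral>\<^sup>+x. ennreal ((2^k) * (d k x)\<^sup>2) \<partial>M)"
    by (rule nn_integral_suminf) measurable
  also have "\<dots> \<le> (\<Sum>k. ennreal ((1/2)^k))"
    by (intro suminf_le int_d) auto
  also have "\<dots> < \<infinity>"
    by (subst suminf_ennreal2) (auto simp: summable_geometric)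
  finally have "AE x in M. (\<Sum>k. ennreal ((2^k) * (d k x)\<^sup>2)) \<noteq> \<infinity>"
    by (intro nn_integral_noteq_infinite) auto
  then have conv: "AE x in M. convergent (\<lambda>k. f (r k) x)"
  proof eventually_elim
    case (elim x)
    then have "summable (\<lambda>k. 2^k * (d k x)\<^sup>2)"
      by (intro summable_suminf_not_top) auto
    then have "summable (\<lambda>k. (1/2)^k + 2^k * (d k x)\<^sup>2)"
      by (intro summable_add) (auto simp: summable_geometric)
    moreover have "norm (f (r (Suc k)) x - f (r k) x) \<le> (1/2)^k + 2^k * (d k x)\<^sup>2" for k
    proof (cases "d k x \<le> (1/2)^k")
      case True
      then show ?thesis unfolding d_def[symmetric] by (smt (verit) zero_le_power2 mult_nonneg_nonneg zero_le_power)
    next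
      case False
      then have "1 \<le> 2^k * d k x" by (simp add: power_one_over field_simps)
      then have "d k x * 1 \<le> d k x * (2^k * d k x)"
        by (intro mult_left_mono) (auto simp: d_def)
      then have "d k x \<le> 2^k * (d k x)\<^sup>2"
        by (simp add: power2_eq_square mult_ac)
      moreover have "(0::real) \<le> (1/2)^k" by simp
      ultimately show ?thesis unfolding d_def[symmetric] by linarith
    qed
    ultimately have "summable (\<lambda>k. f (r (Suc k)) x - f (r k) x)"
      by (rule summable_comparison_test'[where N=0])
    then have "convergent (\<lambda>n. \<Sum>k<n. f (r (Suc k)) x - f (r k) x)"
      by (simp add: summable_iff_convergent)
    then have "convergent (\<lambda>n. f (r n) x - f (r 0) x)"
      by (simp add: sum_lessThan_telescope[of "\<lambda>k. f (r k) x"])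
    from convergent_add[OF this convergent_const[of "f (r 0) x"]]
    show "convergent (\<lambda>k. f (r k) x)" by simp
  qed
  \<comment> \<open>Off the set of convergence \<open>lim\<close> is some unspecified value. The
    function is measurable all the same, and that set is null.\<close>
  define h where "h x = lim (\<lambda>k. f (r k) x)" for x
  have [measurable]: "h \<in> borel_measurable M"
    unfolding h_def by (rule borel_measurable_lim_metric) measurable
  have lim: "AE x in M. (\<lambda>k. f (r k) x) \<longlonglongrightarrow> h x"
    using conv unfolding h_def by eventually_elim (simp add: convergent_LIMSEQ_iff)
  \<comment> \<open>Fatou's lemma along the subsequence turns a Cauchy bound into a bound on the
    distance to \<open>h\<close>. It holds for every large \<open>m\<close>, so the whole sequence
    converges and not only the subsequence.\<close>
  have le: "(\<integral>\<^sup>+x. ennreal ((norm (f m x - h x))\<^sup>2) \<partial>M) \<le> ennreal e"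
    if e: "\<forall>m\<ge>K. \<forall>n\<ge>K. (LINT x|M. (norm (f m x - f n x))\<^sup>2) \<le> e" and m: "m \<ge> K" for K m e
  proof -
    have "(\<integral>\<^sup>+x. ennreal ((norm (f m x - h x))\<^sup>2) \<partial>M)
        = (\<integral>\<^sup>+x. liminf (\<lambda>k. ennreal ((norm (f m x - f (r k) x))\<^sup>2)) \<partial>M)"
    proof (rule nn_integral_cong_AE)
      show "AE x in M. ennreal ((norm (f m x - h x))\<^sup>2) = liminf (\<lambda>k. ennreal ((norm (f m x - f (r k) x))\<^sup>2))"
        using lim
      proof eventually_elim
        case (elim x)
        then have "(\<lambda>k. ennreal ((norm (f m x - f (r k) x))\<^sup>2)) \<longlonglongrightarrow> ennreal ((norm (f m x - h x))\<^sup>2)"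
          by (intro tendsto_ennrealI tendsto_intros)
        from lim_imp_Liminf[OF _ this] show ?case by simp
      qed
    qed
    also have "\<dots> \<le> liminf (\<lambda>k. \<integral>\<^sup>+x. ennreal ((norm (f m x - f (r k) x))\<^sup>2) \<partial>M)"
      by (rule nn_integral_liminf[of "\<lambda>k x. ennreal ((norm (f m x - f (r k) x))\<^sup>2)"]) measurable
    also have "\<dots> \<le> ennreal e"
    proof (rule Liminf_le)
      show "\<forall>\<^sub>F k in sequentially. (\<integral>\<^sup>+x. ennreal ((norm (f m x - f (r k) x))\<^sup>2) \<partial>M) \<le> ennreal e"
        using eventually_ge_at_top[of K]
      proof eventually_elim
        case (elim k)
        then have "r k \<ge> K" using rk[of k] by simp
        then show ?case unfolding eq using e m by (intro ennreal_leI) auto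
      qed
    qed simp
    finally show ?thesis .
  qed
  obtain K where K: "\<forall>m\<ge>K. \<forall>n\<ge>K. (LINT x|M. (norm (f m x - f n x))\<^sup>2) \<le> 1"
    using Cauchy[of 1] by auto
  have "(\<integral>\<^sup>+x. ennreal ((norm (f K x - h x))\<^sup>2) \<partial>M) \<le> ennreal 1"
    using le[OF K] by simp
  also have "\<dots> < \<infinity>" by simp
  finally have "integrable M (\<lambda>x. (norm (f K x - h x))\<^sup>2)"
    by (intro integrableI_bounded) auto
  moreover have "(\<lambda>x. f K x - h x) \<in> borel_measurable M" by measurable
  ultimately have "square_integrable M (\<lambda>x. f K x - h x)"
    unfolding square_integrable_def by blast
  from square_integrable_diff[OF f[of K] this] have h: "square_integrable M h" by simp
  have "(\<lambda>n. LINT x|M. (norm (f n x - h x))\<^sup>2) \<longlonglongrightarrow> 0"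
  proof (rule LIMSEQ_I)
    fix e :: real assume "e > 0"
    then obtain K where K: "\<forall>m\<ge>K. \<forall>n\<ge>K. (LINT x|M. (norm (f m x - f n x))\<^sup>2) \<le> e / 2"
      using Cauchy[of "e/2"] by auto
    have "norm ((LINT x|M. (norm (f n x - h x))\<^sup>2) - 0) < e" if "n \<ge> K" for n
    proof -
      have "ennreal (LINT x|M. (norm (f n x - h x))\<^sup>2) \<le> ennreal (e/2)"
        using le[OF K that] nn_integral_eq_integral[OF square_integrableD[OF square_integrable_diff[OF f[of n] h]]]
        by simp
      then show ?thesis using \<open>e > 0\<close> by (simp add: ennreal_le_iff)
    qed
    then show "\<exists>K. \<forall>n\<ge>K. norm ((LINT x|M. (norm (f n x - h x))\<^sup>2) - 0) < e" by blast
  qed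
  with h show ?thesis by (rule that)
qed

section \<open>Smooth functions and test functions\<close>

definition gradient :: "('a::euclidean_space \<Rightarrow> real) \<Rightarrow> 'a \<Rightarrow> 'a" where
  "gradient \<phi> x = (\<Sum>i\<in>Basis. partial i \<phi> x *\<^sub>R i)"

lemma gradient_inner_Basis: "i \<in> Basis \<Longrightarrow> gradient \<phi> x \<bullet> i = partial i \<phi> x"
  by (simp add: gradient_def inner_sum_left inner_Basis if_distrib cong: if_cong)

lemma partial_eqI: "(\<phi> has_derivative D) (at x) \<Longrightarrow> partial i \<phi> x = D i"
  by (simp add: partial_def frechet_derivative_at[symmetric])

lemma has_derivative_gradient:
  assumes "\<phi> differentiable at x"
  shows "(\<phi> has_derivative (\<lambda>h. gradient \<phi> x \<bullet> h)) (at x)"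
proof -
  let ?D = "frechet_derivative \<phi> (at x)"
  have D: "(\<phi> has_derivative ?D) (at x)"
    using assms frechet_derivative_works by blast
  interpret D: linear ?D by (rule has_derivative_linear[OF D])
  have "?D h = gradient \<phi> x \<bullet> h" for h
  proof -
    have "?D h = ?D (\<Sum>i\<in>Basis. (h \<bullet> i) *\<^sub>R i)" by (simp add: euclidean_representation)
    also have "\<dots> = gradient \<phi> x \<bullet> h"
      unfolding gradient_def partial_def inner_sum_left D.sum D.scaleR
      by (intro sum.cong) (simp_all add: inner_commute)
    finally show ?thesis .
  qed
  then have "?D = (\<lambda>h. gradient \<phi> x \<bullet> h)" by (rule ext)
  with D show ?thesis by (simp only:)
qed

lemma Ck_Suc_imp: "Ck (Suc k) f \<Longrightarrow> Ck k f"
proof (induction k arbitrary: f)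
  case 0
  then show ?case
    by (auto intro!: differentiable_imp_continuous_within simp: continuous_on_eq_continuous_within)
qed simp

lemma Ck_continuous: "Ck k f \<Longrightarrow> continuous_on UNIV f"
  by (induction k) (use Ck_Suc_imp in auto)

lemma Ck_differentiable: "Ck (Suc k) f \<Longrightarrow> f differentiable at x"
  by simp

text \<open>\<open>Ck\<close> recurses through \<open>frechet_derivative\<close>; this rule accepts
  any derivative found by computation. The direction is the first argument of \<open>D\<close>, so
  that \<open>D i\<close> is the partial derivative as a function.\<close>

lemma Ck_SucI:
  assumes "\<And>x. (f has_derivative (\<lambda>h. D h x)) (at x)" and "\<And>i. i \<in> Basis \<Longrightarrow> Ck k (D i)"
  shows "Ck (Suc k) f"
proof -
  have "partial i f = D i" for i
    using partial_eqI[OF assms(1)] by (rule ext)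
  moreover have "f differentiable at x" for x
    using assms(1) differentiableI by blast
  ultimately show ?thesis using assms(2) by simp
qed

lemma Ck_const: "Ck k (\<lambda>x. c)"
proof (induction k arbitrary: c)
  case (Suc k)
  show ?case by (rule Ck_SucI[where D="\<lambda>_ _. 0"]) (auto simp: Suc)
qed auto

lemma Ck_inner: "Ck k (\<lambda>x. x \<bullet> j)"
proof (cases k)
  case (Suc n)
  show ?thesis unfolding Suc
    by (rule Ck_SucI[where D="\<lambda>h _. h \<bullet> j"]) (auto intro!: derivative_eq_intros Ck_const)
qed (auto intro!: continuous_intros)

lemma Ck_add: "Ck k f \<Longrightarrow> Ck k g \<Longrightarrow> Ck k (\<lambda>x. f x + g x)"
proof (induction k arbitrary: f g)
  case (Suc k)
  show ?case
  proof (rule Ck_SucI)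
    show "((\<lambda>x. f x + g x) has_derivative (\<lambda>h. frechet_derivative f (at x) h + frechet_derivative g (at x) h)) (at x)" for x
      using Suc.prems by (intro has_derivative_add) (auto simp: frechet_derivative_works[symmetric])
    show "Ck k (\<lambda>x. frechet_derivative f (at x) i + frechet_derivative g (at x) i)" if "i \<in> Basis" for i
      using Suc.IH[of "partial i f" "partial i g"] Suc.prems that by (simp add: partial_def[abs_def])
  qed
qed (auto intro: continuous_on_add)

lemma Ck_mult: "Ck k f \<Longrightarrow> Ck k g \<Longrightarrow> Ck k (\<lambda>x. f x * g x)"
proof (induction k arbitrary: f g)
  case (Suc k)
  show ?case
  proof (rule Ck_SucI)
    show "((\<lambda>x. f x * g x) has_derivative (\<lambda>h. f x * partial h g x + partial h f x * g x)) (at x)" for x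
      unfolding partial_def
      using Suc.prems by (intro has_derivative_mult) (auto simp: frechet_derivative_works[symmetric])
    show "Ck k (\<lambda>x. f x * partial i g x + partial i f x * g x)" if "i \<in> Basis" for i
      using Suc.prems that Ck_Suc_imp by (intro Ck_add Suc.IH) auto
  qed
qed (auto intro: continuous_on_mult)

lemma Ck_cmult: "Ck k f \<Longrightarrow> Ck k (\<lambda>x. c * f x)"
  by (intro Ck_mult Ck_const)

lemma Ck_prod: "(\<And>i. i \<in> I \<Longrightarrow> Ck k (f i)) \<Longrightarrow> Ck k (\<lambda>x. \<Prod>i\<in>I. f i x)"
  by (induction I rule: infinite_finite_induct) (auto intro: Ck_const Ck_mult)

text \<open>The outer function comes with the sequence of all its derivatives, and the induction
  runs over all members \<open>H n\<close> at once: a partial derivative of \<open>H n\<close> after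
  \<open>f\<close> is \<open>H (Suc n)\<close> after \<open>f\<close> times a partial derivative of
  \<open>f\<close>. No formula for higher derivatives of a composition is needed.\<close>

lemma Ck_compose:
  fixes H :: "nat \<Rightarrow> real \<Rightarrow> real"
  assumes H: "\<And>n t. (H n has_real_derivative H (Suc n) t) (at t)" and f: "\<And>k. Ck k f"
  shows "Ck k (\<lambda>x. H n (f x))"
proof (induction k arbitrary: n)
  case 0
  have "continuous_on UNIV (H n)"
    using H by (auto simp: continuous_on_eq_continuous_within intro: DERIV_isCont)
  then show ?case
    using Ck_continuous[OF f[of 0]] by (auto intro: continuous_on_compose2)
next
  case (Suc k)
  show ?case
  proof (rule Ck_SucI)
    show "((\<lambda>x. H n (f x)) has_derivative (\<lambda>h. H (Suc n) (f x) * partial h f x)) (at x)" for x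
      using diff_chain_at[of f "frechet_derivative f (at x)" x "H n" "(*) (H (Suc n) (f x))"]
        Ck_differentiable[OF f[of "Suc 0"], of x] H[of n "f x"]
      by (simp add: o_def partial_def frechet_derivative_works has_field_derivative_def)
    show "Ck k (\<lambda>x. H (Suc n) (f x) * partial i f x)" if "i \<in> Basis" for i
      using f[of "Suc k"] that by (intro Ck_mult Suc.IH) auto
  qed
qed

lemma partial_mult:
  assumes "f differentiable at x" "g differentiable at x"
  shows "partial i (\<lambda>x. f x * g x) x = f x * partial i g x + partial i f x * g x"
  using partial_eqI[OF has_derivative_mult[OF has_derivative_gradient[OF assms(1)] has_derivative_gradient[OF assms(2)]]]
    partial_eqI[OF has_derivative_gradient[OF assms(1)]] partial_eqI[OF has_derivative_gradient[OF assms(2)]]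
  by simp

lemma gradient_add:
  assumes "f differentiable at x" "g differentiable at x"
  shows "gradient (\<lambda>x. f x + g x) x = gradient f x + gradient g x"
proof -
  have "partial i (\<lambda>x. f x + g x) x = partial i f x + partial i g x" for i
    using partial_eqI[OF has_derivative_add[OF has_derivative_gradient[OF assms(1)] has_derivative_gradient[OF assms(2)]]]
      partial_eqI[OF has_derivative_gradient[OF assms(1)]] partial_eqI[OF has_derivative_gradient[OF assms(2)]]
    by simp
  then show ?thesis by (simp add: gradient_def scaleR_add_left sum.distrib)
qed

lemma gradient_compose:
  assumes "f differentiable at x" "(H has_real_derivative H') (at (f x))"
  shows "gradient (\<lambda>x. H (f x)) x = H' *\<^sub>R gradient f x"
proof -
  have "((\<lambda>x. H (f x)) has_derivative (\<lambda>h. H' * (gradient f x \<bullet> h))) (at x)"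
    using diff_chain_at[OF has_derivative_gradient[OF assms(1)], of H "(*) H'"] assms(2)
    by (simp add: o_def has_field_derivative_def)
  then have "partial i (\<lambda>x. H (f x)) x = H' * partial i f x" for i
    using partial_eqI[OF has_derivative_gradient[OF assms(1)], of i] partial_eqI by simp
  then show ?thesis by (simp add: gradient_def scaleR_sum_right)
qed

lemma gradient_cmult:
  "f differentiable at x \<Longrightarrow> gradient (\<lambda>x. c * f x) x = c *\<^sub>R gradient f x"
  by (rule gradient_compose[where H="\<lambda>t. c * t"]) (auto intro!: derivative_eq_intros)

text \<open>The standard cutoff \<open>exp (-1/t)\<close>, together with all its derivatives, each of which is a
  polynomial in \<open>1/t\<close> times \<open>exp (-1/t)\<close>.\<close>

definition flat_exp :: "real poly \<Rightarrow> real \<Rightarrow> real" where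
  "flat_exp p t = (if t > 0 then poly p (1 / t) * exp (- (1 / t)) else 0)"

lemma poly_mult_exp_tendsto_0: "((\<lambda>s::real. poly p s * exp (- s)) \<longlongrightarrow> 0) at_top"
proof -
  have "((\<lambda>s::real. \<Sum>i\<le>degree p. coeff p i * (s ^ i / exp s)) \<longlongrightarrow> 0) at_top"
    by (intro tendsto_null_sum tendsto_mult_right_zero tendsto_power_div_exp_0)
  moreover have "(\<lambda>s. \<Sum>i\<le>degree p. coeff p i * (s ^ i / exp s)) = (\<lambda>s. poly p s * exp (- s))"
    by (simp add: poly_altdef sum_distrib_right exp_minus divide_inverse mult.assoc)
  ultimately show ?thesis by simp
qed

text \<open>With s = 1/t, differentiating p(s) exp(-s) in t gives s^2 (p(s) - p'(s)) exp(-s), and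
  \<open>[:0,0,1:]\<close> is the polynomial s^2. At \<open>t = 0\<close> the difference quotient
  from the right is s p(s) exp(-s), of the same form with one more factor s, and tends to 0 as s
  tends to infinity.\<close>

lemma flat_exp_has_derivative:
  "(flat_exp p has_real_derivative flat_exp ([:0,0,1:] * (p - pderiv p)) t) (at t)"
proof -
  consider "t > 0" | "t < 0" | "t = 0" by linarith
  then show ?thesis
  proof cases
    case 1
    have "((\<lambda>t. poly p (1 / t) * exp (- (1 / t))) has_real_derivative flat_exp ([:0,0,1:] * (p - pderiv p)) t) (at t)"
      using 1 unfolding flat_exp_def
      by (auto intro!: derivative_eq_intros DERIV_chain2[OF poly_DERIV] simp: field_simps power2_eq_square)
    then show ?thesis
      by (rule has_field_derivative_transform_within_open[of _ _ _ "{0<..}"])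
        (use 1 in \<open>auto simp: flat_exp_def\<close>)
  next
    case 2
    have "((\<lambda>t. 0) has_real_derivative flat_exp ([:0,0,1:] * (p - pderiv p)) t) (at t)"
      using 2 by (simp add: flat_exp_def)
    then show ?thesis
      by (rule has_field_derivative_transform_within_open[of _ _ _ "{..<0}"])
        (use 2 in \<open>auto simp: flat_exp_def\<close>)
  next
    case 3
    have "((\<lambda>h. flat_exp p h / h) \<longlongrightarrow> 0) (at 0)"
    proof (rule filterlim_split_at_real)
      show "((\<lambda>h. flat_exp p h / h) \<longlongrightarrow> 0) (at_left 0)"
        by (rule tendsto_eventually) (auto simp: eventually_at_filter flat_exp_def)
      have "((\<lambda>h::real. poly ([:0,1:] * p) (inverse h) * exp (- inverse h)) \<longlongrightarrow> 0) (at_right 0)"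
        by (rule filterlim_compose[OF poly_mult_exp_tendsto_0 filterlim_inverse_at_top_right])
      then show "((\<lambda>h. flat_exp p h / h) \<longlongrightarrow> 0) (at_right 0)"
        by (rule Lim_transform_eventually)
          (auto simp: eventually_at_filter flat_exp_def field_simps)
    qed
    then show ?thesis
      by (simp add: 3 has_field_derivative_iff flat_exp_def)
  qed
qed

definition cutoff :: "real \<Rightarrow> real" where
  "cutoff = flat_exp 1"

lemma cutoff_pos: "t > 0 \<Longrightarrow> cutoff t = exp (- (1 / t))"
  and cutoff_nonpos: "t \<le> 0 \<Longrightarrow> cutoff t = 0"
  and cutoff_nonneg: "0 \<le> cutoff t"
  and cutoff_le_1: "cutoff t \<le> 1"
  by (auto simp: cutoff_def flat_exp_def)

lemma Ck_cutoff:
  assumes "\<And>k. Ck k f"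
  shows "Ck k (\<lambda>x. cutoff (f x))"
proof -
  \<comment> \<open>The n-th derivative of the cutoff is \<open>flat_exp\<close> of the n-th iterate
    of the map from p to s^2 (p - p'), started at 1; the cutoff itself is the instance 0.\<close>
  have "Ck k (\<lambda>x. flat_exp (((\<lambda>p. [:0,0,1:] * (p - pderiv p)) ^^ 0) 1) (f x))"
    by (rule Ck_compose[where H="\<lambda>n. flat_exp (((\<lambda>p. [:0,0,1:] * (p - pderiv p)) ^^ n) 1)"])
      (auto simp only: funpow.simps o_apply intro: flat_exp_has_derivative assms)
  then show ?thesis by (simp add: cutoff_def)
qed

text \<open>The parameter \<open>n\<close> sits inside the cutoffs: exp(-1/(n t)) tends to 1 for
  every positive t, so with the support fixed the bumps converge pointwise to the indicator of the
  open box while staying between 0 and 1.\<close>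

definition box_bump :: "nat \<Rightarrow> 'a::euclidean_space \<Rightarrow> 'a \<Rightarrow> 'a \<Rightarrow> real" where
  "box_bump n a b x = (\<Prod>i\<in>Basis. cutoff (real n * (x \<bullet> i - a \<bullet> i)) * cutoff (real n * (b \<bullet> i - x \<bullet> i)))"

lemma Ck_box_bump: "Ck k (box_bump n a b)"
proof -
  have *: "Ck k (\<lambda>x::'a. c * (x \<bullet> i) + d)" for k c i d
    by (intro Ck_add Ck_cmult Ck_inner Ck_const)
  have "Ck k (\<lambda>x. cutoff (real n * (x \<bullet> i - a \<bullet> i)))" "Ck k (\<lambda>x. cutoff (real n * (b \<bullet> i - x \<bullet> i)))" for i
    using Ck_cutoff[OF *[of _ "real n" i "- (real n * (a \<bullet> i))"], of k] Ck_cutoff[OF *[of _ "- real n" i "real n * (b \<bullet> i)"], of k]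
    by (simp_all add: algebra_simps)
  then have "Ck k (\<lambda>x. \<Prod>i\<in>Basis. cutoff (real n * (x \<bullet> i - a \<bullet> i)) * cutoff (real n * (b \<bullet> i - x \<bullet> i)))"
    by (intro Ck_prod Ck_mult)
  then show ?thesis by (simp add: box_bump_def[abs_def])
qed

lemma box_bump_bounds: "0 \<le> box_bump n a b x" "box_bump n a b x \<le> 1"
  unfolding box_bump_def
  by (auto intro!: prod_nonneg prod_le_1 mult_nonneg_nonneg mult_le_one cutoff_nonneg cutoff_le_1)

lemma box_bump_outside: "x \<notin> box a b \<Longrightarrow> box_bump n a b x = 0"
  unfolding box_bump_def mem_box
  by (auto simp: not_less intro!: prod_zero cutoff_nonpos mult_nonneg_nonpos)

lemma box_bump_tendsto: "(\<lambda>n. box_bump n a b x) \<longlonglongrightarrow> indicator (box a b) x"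
proof (cases "x \<in> box a b")
  case True
  have *: "(\<lambda>n. cutoff (real n * t)) \<longlonglongrightarrow> 1" if "t > 0" for t
  proof (rule Lim_transform_eventually)
    have "(\<lambda>n. exp (- ((1 / t) * (1 / real n)))) \<longlonglongrightarrow> exp (- ((1 / t) * 0))"
      by (intro tendsto_intros lim_1_over_n)
    then show "(\<lambda>n. exp (- ((1 / t) * (1 / real n)))) \<longlonglongrightarrow> 1" by simp
    show "\<forall>\<^sub>F n in sequentially. exp (- ((1 / t) * (1 / real n))) = cutoff (real n * t)"
      using eventually_gt_at_top[of 0]
      by eventually_elim (use that in \<open>simp add: cutoff_pos mult.commute\<close>)
  qed
  have "(\<lambda>n. box_bump n a b x) \<longlonglongrightarrow> (\<Prod>i\<in>(Basis::'a set). 1 * 1)"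
    unfolding box_bump_def
    by (intro tendsto_prod tendsto_mult *) (use True in \<open>auto simp: mem_box\<close>)
  then show ?thesis using True by simp
qed (simp add: box_bump_outside)

section \<open>Test functions\<close>

lemma test_fun_Ck: "test_fun \<Omega> \<phi> \<Longrightarrow> Ck k \<phi>"
  by (simp add: test_fun_def)

lemma test_fun_differentiable: "test_fun \<Omega> \<phi> \<Longrightarrow> \<phi> differentiable at x"
  using Ck_differentiable test_fun_Ck by blast

lemma test_fun_continuous: "test_fun \<Omega> \<phi> \<Longrightarrow> continuous_on S \<phi>"
  using Ck_continuous test_fun_Ck continuous_on_subset by blast

lemma test_funI:
  assumes "\<And>k. Ck k \<psi>" "{x. \<psi> x \<noteq> 0} \<subseteq> K" "compact K" "K \<subseteq> \<Omega>"
  shows "test_fun \<Omega> \<psi>"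
proof -
  have "closure {x. \<psi> x \<noteq> 0} \<subseteq> K"
    using assms(2,3) by (simp add: closure_minimal compact_imp_closed)
  then show ?thesis
    using assms unfolding test_fun_def
    by (metis compact_closure bounded_subset compact_imp_bounded order_trans closure_subset)
qed

lemma test_fun_support:
  assumes "test_fun \<Omega> \<phi>"
  obtains K where "compact K" "K \<subseteq> \<Omega>" "\<And>x. x \<notin> K \<Longrightarrow> \<phi> x = 0" "\<And>x i. x \<notin> K \<Longrightarrow> partial i \<phi> x = 0"
proof
  let ?K = "closure {x. \<phi> x \<noteq> 0}"
  show "compact ?K" "?K \<subseteq> \<Omega>" using assms by (auto simp: test_fun_def)
  show *: "\<phi> x = 0" if "x \<notin> ?K" for x
    using that closure_subset[of "{x. \<phi> x \<noteq> 0}"] by blast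
  show "partial i \<phi> x = 0" if "x \<notin> ?K" for x i
  proof -
    have "((\<lambda>x. 0) has_derivative (\<lambda>h. 0)) (at x)" by simp
    then have "(\<phi> has_derivative (\<lambda>h. 0)) (at x)"
    proof (rule has_derivative_transform_within_open)
      show "open (- ?K)" "x \<in> - ?K" using that by auto
      show "0 = \<phi> y" if "y \<in> - ?K" for y
        using *[of y] that by simp
    qed
    then show ?thesis by (rule partial_eqI)
  qed
qed

lemma test_fun_zero_outside:
  "test_fun \<Omega> \<phi> \<Longrightarrow> x \<notin> \<Omega> \<Longrightarrow> \<phi> x = 0" "test_fun \<Omega> \<phi> \<Longrightarrow> x \<notin> \<Omega> \<Longrightarrow> partial i \<phi> x = 0"
  by (erule test_fun_support; blast)+

lemma test_fun_smaller:
  assumes "test_fun \<Omega> \<phi>" "\<And>k. Ck k \<psi>" "\<And>x. \<phi> x = 0 \<Longrightarrow> \<psi> x = 0"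
  shows "test_fun \<Omega> \<psi>"
proof (rule test_fun_support[OF assms(1)])
  fix K assume "compact K" "K \<subseteq> \<Omega>" and K: "\<And>x. x \<notin> K \<Longrightarrow> \<phi> x = 0"
  moreover have "{x. \<psi> x \<noteq> 0} \<subseteq> K" using K assms(3) by blast
  ultimately show ?thesis by (intro test_funI[OF assms(2)])
qed

lemma test_fun_mult: "test_fun \<Omega> \<phi> \<Longrightarrow> (\<And>k. Ck k \<psi>) \<Longrightarrow> test_fun \<Omega> (\<lambda>x. \<phi> x * \<psi> x)"
  by (rule test_fun_smaller) (auto intro: Ck_mult test_fun_Ck)

lemma test_fun_cmult: "test_fun \<Omega> \<phi> \<Longrightarrow> test_fun \<Omega> (\<lambda>x. c * \<phi> x)"
  using test_fun_mult[OF _ Ck_const, of \<Omega> \<phi> c] by (simp add: mult.commute)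

lemma test_fun_add:
  assumes "test_fun \<Omega> \<phi>" "test_fun \<Omega> \<psi>"
  shows "test_fun \<Omega> (\<lambda>x. \<phi> x + \<psi> x)"
proof -
  obtain K where K: "compact K" "K \<subseteq> \<Omega>" "\<And>x. x \<notin> K \<Longrightarrow> \<phi> x = 0"
    using assms(1) test_fun_support by metis
  obtain L where L: "compact L" "L \<subseteq> \<Omega>" "\<And>x. x \<notin> L \<Longrightarrow> \<psi> x = 0"
    using assms(2) test_fun_support by metis
  show ?thesis
  proof (rule test_funI[where K="K \<union> L"])
    show "{x. \<phi> x + \<psi> x \<noteq> 0} \<subseteq> K \<union> L"
      using K(3) L(3) by fastforce
  qed (use K L in \<open>auto intro: Ck_add test_fun_Ck[OF assms(1)] test_fun_Ck[OF assms(2)]\<close>)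
qed

lemma test_fun_zero: "test_fun \<Omega> (\<lambda>x. 0)"
  by (rule test_funI[where K="{}"]) (auto intro: Ck_const)

lemma test_fun_diff:
  "test_fun \<Omega> \<phi> \<Longrightarrow> test_fun \<Omega> \<psi> \<Longrightarrow> test_fun \<Omega> (\<lambda>x. \<phi> x - \<psi> x)"
  using test_fun_add[of \<Omega> \<phi> "\<lambda>x. (-1) * \<psi> x"] test_fun_cmult[of \<Omega> \<psi> "-1"] by simp

lemma gradient_diff:
  assumes "f differentiable at x" "g differentiable at x"
  shows "gradient (\<lambda>x. f x - g x) x = gradient f x - gradient g x"
proof -
  have "(\<lambda>x. (-1) * g x) differentiable at x"
    using assms(2) by (intro differentiable_mult) auto
  then show ?thesis
    using gradient_add[OF assms(1), of "\<lambda>x. (-1) * g x"] gradient_cmult[OF assms(2), of "-1"] by simp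
qed

lemma test_fun_poly:
  assumes "test_fun \<Omega> \<phi>"
  shows "test_fun \<Omega> (\<lambda>x. \<Sum>i\<le>n. c i * \<phi> x ^ Suc i)"
proof (induction n)
  have *: "test_fun \<Omega> (\<lambda>x. \<phi> x ^ Suc i)" for i
  proof (induction i)
    case (Suc i)
    have "test_fun \<Omega> (\<lambda>x. \<phi> x ^ Suc i * \<phi> x)"
      by (rule test_fun_mult[OF Suc test_fun_Ck[OF assms]])
    then show ?case by (simp add: mult_ac)
  qed (use assms in simp)
  {
    case 0
    show ?case using test_fun_cmult[OF *[of 0], of "c 0"] by simp
  next
    case (Suc n)
    show ?case using test_fun_add[OF Suc test_fun_cmult[OF *[of "Suc n"], of "c (Suc n)"]] by simp
  }
qed

lemma test_fun_box_bump:
  assumes "cbox a b \<subseteq> \<Omega>"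
  shows "test_fun \<Omega> (box_bump n a b)"
proof (rule test_funI[OF Ck_box_bump])
  show "{x. box_bump n a b x \<noteq> 0} \<subseteq> cbox a b"
    using box_bump_outside box_subset_cbox by blast
qed (use assms in auto)

lemma test_fun_partial:
  assumes "test_fun \<Omega> \<phi>" "i \<in> Basis"
  shows "test_fun \<Omega> (partial i \<phi>)"
proof (rule test_fun_support[OF assms(1)])
  fix K assume "compact K" "K \<subseteq> \<Omega>" "\<And>x i. x \<notin> K \<Longrightarrow> partial i \<phi> x = 0"
  moreover have "Ck k (partial i \<phi>)" for k
    using test_fun_Ck[OF assms(1), of "Suc k"] assms(2) by simp
  ultimately show ?thesis by (intro test_funI[where K=K]) auto
qed

lemma test_fun_bounded:
  assumes "test_fun \<Omega> \<phi>"
  obtains C where "C \<ge> 0" "\<And>x. \<bar>\<phi> x\<bar> \<le> C"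
proof -
  obtain K where K: "compact K" "\<And>x. x \<notin> K \<Longrightarrow> \<phi> x = 0"
    using test_fun_support[OF assms] by metis
  have "bounded (\<phi> ` K)"
    by (intro compact_imp_bounded compact_continuous_image test_fun_continuous[OF assms] K)
  then obtain C where "\<And>x. x \<in> K \<Longrightarrow> \<bar>\<phi> x\<bar> \<le> C" unfolding bounded_iff by auto
  then have "\<bar>\<phi> x\<bar> \<le> max 0 C" for x using K(2)[of x] by (cases "x \<in> K") force+
  then show ?thesis by (intro that[of "max 0 C"]) auto
qed

lemma continuous_on_gradient: "test_fun \<Omega> \<phi> \<Longrightarrow> continuous_on S (gradient \<phi>)"
  unfolding gradient_def[abs_def]
  by (intro continuous_on_sum continuous_on_scaleR test_fun_continuous[OF test_fun_partial] continuous_on_const)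

lemma gradient_bounded:
  assumes "test_fun \<Omega> \<phi>"
  obtains C where "C \<ge> 0" "\<And>x. norm (gradient \<phi> x) \<le> C"
proof -
  have "\<exists>C. \<forall>x. \<bar>partial i \<phi> x\<bar> \<le> C" if "i \<in> Basis" for i
    using test_fun_bounded[OF test_fun_partial[OF assms that]] by metis
  then obtain C where C: "\<And>i x. i \<in> Basis \<Longrightarrow> \<bar>partial i \<phi> x\<bar> \<le> C i" by metis
  have "norm (gradient \<phi> x) \<le> (\<Sum>i\<in>Basis. C i)" for x
    unfolding gradient_def by (rule sum_norm_le) (simp add: C)
  then show ?thesis
    by (intro that[of "\<Sum>i\<in>Basis. C i"]) (auto intro: order_trans[OF norm_ge_zero])
qed

section \<open>Weak derivatives\<close>

text \<open>Moves integrals of compactly supported functions to the whole space, where translation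
  invariance of \<open>lborel\<close> is available.\<close>

lemma integral_lebesgue_on_zero_outside:
  fixes f :: "'a::euclidean_space \<Rightarrow> real"
  assumes "\<Omega> \<in> sets lebesgue" "f \<in> borel_measurable borel" "\<And>x. x \<notin> \<Omega> \<Longrightarrow> f x = 0"
  shows "(LINT x|lebesgue_on \<Omega>. f x) = (LINT x|lborel. f x)"
proof -
  have "(LINT x|lebesgue_on \<Omega>. f x) = (LINT x|lebesgue. indicator \<Omega> x *\<^sub>R f x)"
    using assms(1) by (intro integral_restrict_space) auto
  also have "\<dots> = (LINT x|lebesgue. f x)"
    using assms(3) by (intro Bochner_Integration.integral_cong) (auto simp: indicator_def)
  also have "\<dots> = (LINT x|lborel. f x)"
    using assms(2) by (intro integral_completion) auto
  finally show ?thesis .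
qed

lemma test_fun_integrable:
  assumes "test_fun \<Omega> \<phi>"
  shows "integrable lborel \<phi>"
proof (rule test_fun_support[OF assms])
  fix K assume K: "compact K" "\<And>x. x \<notin> K \<Longrightarrow> \<phi> x = 0"
  have "integrable lborel (\<lambda>x. indicator K x *\<^sub>R \<phi> x)"
    by (rule borel_integrable_compact[OF K(1) test_fun_continuous[OF assms]])
  moreover have "(\<lambda>x. indicator K x *\<^sub>R \<phi> x) = \<phi>"
    using K(2) by (auto simp: indicator_def fun_eq_iff)
  ultimately show ?thesis by simp
qed

lemma integral_translate_lborel:
  fixes f :: "'a::euclidean_space \<Rightarrow> real"
  assumes [measurable]: "f \<in> borel_measurable borel"
  shows "(LINT x|lborel. f (c + x)) = (LINT x|lborel. f x)"
    and "integrable lborel f \<Longrightarrow> integrable lborel (\<lambda>x. f (c + x))"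
proof -
  have "(LINT x|lborel. f x) = (LINT x|distr lborel borel ((+) c). f x)"
    by (simp add: lborel_distr_plus)
  also have "\<dots> = (LINT x|lborel. f (c + x))"
    by (rule integral_distr) measurable
  finally show "(LINT x|lborel. f (c + x)) = (LINT x|lborel. f x)" by simp
  assume "integrable lborel f"
  then have "integrable (distr lborel borel ((+) c)) f"
    by (simp add: lborel_distr_plus)
  then show "integrable lborel (\<lambda>x. f (c + x))"
    by (subst (asm) integrable_distr_eq) measurable
qed

lemma borel_measurable_test_fun: "test_fun \<Omega> \<phi> \<Longrightarrow> \<phi> \<in> borel_measurable borel"
  by (intro borel_measurable_continuous_onI test_fun_continuous)

text \<open>Difference quotients integrate to zero by translation invariance.\<close>

lemma integral_partial_eq_0:
  assumes \<psi>: "test_fun \<Omega> \<psi>" and i: "i \<in> Basis"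
  shows "(LINT x|lborel. partial i \<psi> x) = 0"
proof (rule test_fun_support[OF \<psi>])
  fix K assume K: "compact K" "\<And>x. x \<notin> K \<Longrightarrow> \<psi> x = 0"
  note [measurable] = borel_measurable_test_fun[OF \<psi>] borel_measurable_test_fun[OF test_fun_partial[OF \<psi> i]]
  obtain R where "\<And>x. x \<in> K \<Longrightarrow> norm x \<le> R"
    using compact_imp_bounded[OF K(1)] unfolding bounded_iff by blast
  then have R: "K \<subseteq> cball 0 R" by auto
  obtain C where C: "C \<ge> 0" "\<And>x. norm (gradient \<psi> x) \<le> C" using gradient_bounded[OF \<psi>] by blast
  define h where "h n = 1 / real (Suc n)" for n
  have h: "0 < h n" "h n \<le> 1" for n by (auto simp: h_def)
  have h0: "h \<longlonglongrightarrow> 0" unfolding h_def by (rule LIMSEQ_Suc[OF lim_1_over_n])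
  define q where "q n x = (\<psi> (h n *\<^sub>R i + x) - \<psi> x) / h n" for n x
  have lip: "norm (\<psi> x - \<psi> y) \<le> C * norm (x - y)" for x y
  proof (rule differentiable_bound[of UNIV \<psi> "\<lambda>x h. gradient \<psi> x \<bullet> h"])
    show "onorm (\<lambda>h. gradient \<psi> x \<bullet> h) \<le> C" for x
    proof (rule onorm_le)
      fix h show "norm (gradient \<psi> x \<bullet> h) \<le> C * norm h"
        using Cauchy_Schwarz_ineq2[of "gradient \<psi> x" h] mult_right_mono[OF C(2)[of x], of "norm h"] by simp
    qed
  qed (use has_derivative_gradient[OF test_fun_differentiable[OF \<psi>]] in auto)
  have "(\<lambda>n. LINT x|lborel. q n x) \<longlonglongrightarrow> (LINT x|lborel. partial i \<psi> x)"
  proof (rule integral_dominated_convergence)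
    show "partial i \<psi> \<in> borel_measurable lborel" "q n \<in> borel_measurable lborel" for n
      unfolding q_def by measurable
    \<comment> \<open>Since \<open>h n \<le> 1\<close>, both \<open>x\<close> and its shift miss
      \<open>K\<close> once \<open>x\<close> lies outside the ball of radius \<open>R + 1\<close>;
      inside that ball the Lipschitz constant \<open>C\<close> bounds the quotient.\<close>
    show "integrable lborel (\<lambda>x. C * indicator (cball (0::'a) (R + 1)) x)"
      using borel_integrable_compact[of "cball (0::'a) (R + 1)" "\<lambda>_. C"] by (simp add: mult.commute)
    show "AE x in lborel. (\<lambda>n. q n x) \<longlonglongrightarrow> partial i \<psi> x"
    proof (rule AE_I2)
      fix x
      have "((\<lambda>t. \<psi> (x + t *\<^sub>R i)) has_real_derivative (gradient \<psi> x \<bullet> i)) (at 0)"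
      proof -
        have "((\<lambda>t. x + t *\<^sub>R i) has_derivative (\<lambda>t. t *\<^sub>R i)) (at 0)"
          by (auto intro!: derivative_eq_intros)
        moreover have "(\<psi> has_derivative (\<lambda>h. gradient \<psi> x \<bullet> h)) (at (x + 0 *\<^sub>R i))"
          using has_derivative_gradient[OF test_fun_differentiable[OF \<psi>], of x] by simp
        ultimately have "((\<lambda>t. \<psi> (x + t *\<^sub>R i)) has_derivative (\<lambda>t. gradient \<psi> x \<bullet> (t *\<^sub>R i))) (at 0)"
          using diff_chain_at unfolding o_def by blast
        moreover have "(\<lambda>t. gradient \<psi> x \<bullet> (t *\<^sub>R i)) = (*) (gradient \<psi> x \<bullet> i)"
          by (auto simp: fun_eq_iff)
        ultimately show ?thesis by (simp add: has_field_derivative_def)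
      qed
      then have "((\<lambda>t. (\<psi> (x + t *\<^sub>R i) - \<psi> x) / t) \<longlongrightarrow> partial i \<psi> x) (at 0)"
        by (simp add: has_field_derivative_iff gradient_inner_Basis i)
      moreover have "filterlim h (at 0) sequentially"
        using h0 h(1) by (intro filterlim_atI) (auto intro: always_eventually simp: less_imp_neq[symmetric])
      ultimately have "(\<lambda>n. (\<psi> (x + h n *\<^sub>R i) - \<psi> x) / h n) \<longlonglongrightarrow> partial i \<psi> x"
        by (rule filterlim_compose)
      then show "(\<lambda>n. q n x) \<longlonglongrightarrow> partial i \<psi> x" by (simp add: q_def add.commute)
    qed
    show "AE x in lborel. norm (q n x) \<le> C * indicator (cball 0 (R + 1)) x" for n
    proof (rule AE_I2)
      fix x
      show "norm (q n x) \<le> C * indicator (cball 0 (R + 1)) x"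
      proof (cases "x \<in> cball 0 (R + 1)")
        case True
        have "norm (\<psi> (h n *\<^sub>R i + x) - \<psi> x) \<le> C * h n"
          using lip[of "h n *\<^sub>R i + x" x] h(1)[of n] i by simp
        then show ?thesis using True h(1)[of n] by (simp add: q_def field_simps)
      next
        case False
        have "norm x \<le> norm (h n *\<^sub>R i + x) + norm (h n *\<^sub>R i)"
          using norm_triangle_ineq4[of "h n *\<^sub>R i + x" "h n *\<^sub>R i"] by simp
        moreover have "norm (h n *\<^sub>R i) \<le> 1" "R + 1 < norm x" using h[of n] i False by auto
        ultimately have "x \<notin> cball 0 R" "h n *\<^sub>R i + x \<notin> cball 0 R"
          unfolding mem_cball_0 by linarith+
        with R have "x \<notin> K" "h n *\<^sub>R i + x \<notin> K" by blast+
        then show ?thesis using K(2) False by (simp add: q_def)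
      qed
    qed
  qed
  moreover have "(LINT x|lborel. q n x) = 0" for n
  proof -
    have "(LINT x|lborel. \<psi> (h n *\<^sub>R i + x) - \<psi> x) = 0"
      using test_fun_integrable[OF \<psi>]
      by (subst Bochner_Integration.integral_diff) (auto simp: integral_translate_lborel)
    then show ?thesis unfolding q_def by simp
  qed
  ultimately show ?thesis by (simp add: LIMSEQ_const_iff)
qed

text \<open>The product of \<open>\<phi>\<close> and \<open>u\<close> is again a test function, so
  its partial derivative integrates to zero over the whole space, and the product rule splits that
  integral.\<close>

lemma integral_by_parts_test_fun:
  assumes \<Omega>: "\<Omega> \<in> sets lebesgue" and \<phi>: "test_fun \<Omega> \<phi>" and u: "\<And>k. Ck k u" and i: "i \<in> Basis"
  shows "(LINT x|lebesgue_on \<Omega>. u x * partial i \<phi> x) = - (LINT x|lebesgue_on \<Omega>. partial i u x * \<phi> x)"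
proof -
  have 1: "test_fun \<Omega> (\<lambda>x. \<phi> x * partial i u x)"
    using u[of "Suc _"] i by (intro test_fun_mult \<phi>) auto
  have 2: "test_fun \<Omega> (\<lambda>x. partial i \<phi> x * u x)"
    by (intro test_fun_mult test_fun_partial \<phi> u i)
  have "0 = (LINT x|lborel. partial i (\<lambda>x. \<phi> x * u x) x)"
    by (rule integral_partial_eq_0[OF test_fun_mult[OF \<phi> u] i, symmetric])
  also have "\<dots> = (LINT x|lborel. \<phi> x * partial i u x + partial i \<phi> x * u x)"
    using Ck_differentiable[OF u[of "Suc 0"]]
    by (simp add: partial_mult[OF test_fun_differentiable[OF \<phi>]])
  also have "\<dots> = (LINT x|lborel. \<phi> x * partial i u x) + (LINT x|lborel. partial i \<phi> x * u x)"
    by (intro Bochner_Integration.integral_add test_fun_integrable[OF 1] test_fun_integrable[OF 2])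
  also have "(LINT x|lborel. \<phi> x * partial i u x) = (LINT x|lebesgue_on \<Omega>. \<phi> x * partial i u x)"
    by (rule integral_lebesgue_on_zero_outside[OF \<Omega> borel_measurable_test_fun[OF 1], symmetric])
      (simp add: test_fun_zero_outside[OF \<phi>])
  also have "(LINT x|lborel. partial i \<phi> x * u x) = (LINT x|lebesgue_on \<Omega>. partial i \<phi> x * u x)"
    by (rule integral_lebesgue_on_zero_outside[OF \<Omega> borel_measurable_test_fun[OF 2], symmetric])
      (simp add: test_fun_zero_outside[OF \<phi>])
  finally show ?thesis by (simp add: mult.commute)
qed

text \<open>\<open>LINT\<close> assigns 0 to a function that is not integrable, so linearity of the
  integrals in \<open>has_weak_partial\<close> has to be backed by integrability. It holds because
  the product lives on a compact subset of \<Omega>.\<close>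

lemma locally_integrable_mult_test_fun:
  assumes \<Omega>: "\<Omega> \<in> sets lebesgue" and g: "locally_integrable \<Omega> g" and \<phi>: "test_fun \<Omega> \<phi>"
  shows "integrable (lebesgue_on \<Omega>) (\<lambda>x. g x * \<phi> x)"
proof (rule test_fun_support[OF \<phi>])
  fix K assume K: "compact K" "K \<subseteq> \<Omega>" "\<And>x. x \<notin> K \<Longrightarrow> \<phi> x = 0"
  obtain C where C: "\<And>x. \<bar>\<phi> x\<bar> \<le> C" using test_fun_bounded[OF \<phi>] by blast
  have gK: "integrable lebesgue (\<lambda>x. indicator K x *\<^sub>R g x)"
    using g K unfolding locally_integrable_def set_integrable_def by blast
  have [measurable]: "\<phi> \<in> borel_measurable lebesgue"
    using borel_measurable_test_fun[OF \<phi>] by (simp add: measurable_completion)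
  have "integrable lebesgue (\<lambda>x. (indicator K x *\<^sub>R g x) * \<phi> x)"
  proof (rule Bochner_Integration.integrable_bound)
    show "integrable lebesgue (\<lambda>x. C *\<^sub>R (indicator K x *\<^sub>R g x))"
      using gK by simp
    show "(\<lambda>x. (indicator K x *\<^sub>R g x) * \<phi> x) \<in> borel_measurable lebesgue"
      by (rule borel_measurable_times[OF borel_measurable_integrable[OF gK]]) measurable
    have "\<bar>g x\<bar> * \<bar>\<phi> x\<bar> \<le> \<bar>C\<bar> * \<bar>g x\<bar>" for x
      using mult_left_mono[OF C[of x], of "\<bar>g x\<bar>"] mult_right_mono[OF abs_ge_self[of C], of "\<bar>g x\<bar>"]
      by (simp add: mult.commute)
    then show "AE x in lebesgue. norm ((indicator K x *\<^sub>R g x) * \<phi> x) \<le> norm (C *\<^sub>R (indicator K x *\<^sub>R g x))"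
      by (auto simp: abs_mult indicator_def)
  qed
  moreover have "(\<lambda>x. (indicator K x *\<^sub>R g x) * \<phi> x) = (\<lambda>x. indicator \<Omega> x *\<^sub>R (g x * \<phi> x))"
    using K by (auto simp: indicator_def fun_eq_iff)
  ultimately show ?thesis
    using \<Omega> by (subst integrable_restrict_space) auto
qed

text \<open>Mollified indicators of boxes show that \<open>g\<close> integrates to zero over every box in \<open>\<Omega>\<close>;
  Lebesgue differentiation then gives \<open>g = 0\<close>.\<close>

lemma fundamental_lemma_box:
  fixes g :: "'a::euclidean_space \<Rightarrow> real"
  assumes \<Omega>: "\<Omega> \<in> sets lebesgue" and g: "locally_integrable \<Omega> g"
    and 0: "\<And>\<phi>. test_fun \<Omega> \<phi> \<Longrightarrow> (LINT x|lebesgue_on \<Omega>. g x * \<phi> x) = 0"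
    and ab: "cbox a b \<subseteq> \<Omega>"
  shows "integral (cbox a b) g = 0"
proof -
  have gK: "g absolutely_integrable_on cbox a b"
    using g ab compact_cbox[of a b] unfolding locally_integrable_def by blast
  then have int: "integrable lebesgue (\<lambda>x. indicator (cbox a b) x *\<^sub>R g x)"
    by (simp add: set_integrable_def)
  note meas = borel_measurable_integrable[OF int]
  have bump: "box_bump n a b \<in> borel_measurable lebesgue" for n
    using borel_measurable_continuous_onI[OF Ck_continuous[OF Ck_box_bump]] by (intro measurable_completion) auto
  have "(\<lambda>n. LINT x|lebesgue. (indicator (cbox a b) x *\<^sub>R g x) * box_bump n a b x)
      \<longlonglongrightarrow> (LINT x|lebesgue. (indicator (cbox a b) x *\<^sub>R g x) * indicator (box a b) x)"
  proof (rule integral_dominated_convergence)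
    show "integrable lebesgue (\<lambda>x. norm (indicator (cbox a b) x *\<^sub>R g x))"
      using int by (rule integrable_norm)
    show "AE x in lebesgue. (\<lambda>n. (indicator (cbox a b) x *\<^sub>R g x) * box_bump n a b x)
        \<longlonglongrightarrow> (indicator (cbox a b) x *\<^sub>R g x) * indicator (box a b) x"
      by (intro AE_I2 tendsto_mult_left box_bump_tendsto)
    show "AE x in lebesgue. norm ((indicator (cbox a b) x *\<^sub>R g x) * box_bump n a b x)
        \<le> norm (indicator (cbox a b) x *\<^sub>R g x)" for n
      by (intro AE_I2) (auto simp: abs_mult box_bump_bounds intro!: mult_right_le_one_le)
    show "(\<lambda>x. (indicator (cbox a b) x *\<^sub>R g x) * indicator (box a b) x) \<in> borel_measurable lebesgue"
      by (rule borel_measurable_times[OF meas borel_measurable_indicator]) simp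
    show "(\<lambda>x. (indicator (cbox a b) x *\<^sub>R g x) * box_bump n a b x) \<in> borel_measurable lebesgue" for n
      by (rule borel_measurable_times[OF meas bump])
  qed
  moreover have "(LINT x|lebesgue. (indicator (cbox a b) x *\<^sub>R g x) * box_bump n a b x) = 0" for n
  proof -
    have "(LINT x|lebesgue_on \<Omega>. g x * box_bump n a b x) = (LINT x|lebesgue. indicator \<Omega> x *\<^sub>R (g x * box_bump n a b x))"
      using \<Omega> by (intro integral_restrict_space) auto
    also have "\<dots> = (LINT x|lebesgue. (indicator (cbox a b) x *\<^sub>R g x) * box_bump n a b x)"
      using ab box_subset_cbox[of a b] box_bump_outside[of _ a b n]
      by (intro Bochner_Integration.integral_cong) (auto simp: indicator_def)
    finally show ?thesis using 0[OF test_fun_box_bump[OF ab]] by simp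
  qed
  ultimately have "(LINT x|lebesgue. (indicator (cbox a b) x *\<^sub>R g x) * indicator (box a b) x) = 0"
    by (simp add: LIMSEQ_const_iff)
  moreover have "(\<lambda>x. (indicator (cbox a b) x *\<^sub>R g x) * indicator (box a b) x) = (\<lambda>x. indicator (box a b) x *\<^sub>R g x)"
    using box_subset_cbox[of a b] by (auto simp: indicator_def fun_eq_iff)
  ultimately have "set_lebesgue_integral lebesgue (box a b) g = 0"
    unfolding set_lebesgue_integral_def by simp
  moreover have "g absolutely_integrable_on box a b"
    by (rule set_integrable_subset[OF gK _ box_subset_cbox]) simp
  ultimately show ?thesis
    by (simp add: set_lebesgue_integral_eq_integral integral_open_interval)
qed

theorem fundamental_lemma:
  fixes g :: "'a::euclidean_space \<Rightarrow> real"
  assumes \<Omega>: "open \<Omega>" and g: "locally_integrable \<Omega> g"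
    and 0: "\<And>\<phi>. test_fun \<Omega> \<phi> \<Longrightarrow> (LINT x|lebesgue_on \<Omega>. g x * \<phi> x) = 0"
  shows "AE x in lebesgue_on \<Omega>. g x = 0"
proof -
  have \<Omega>': "\<Omega> \<in> sets lebesgue" using \<Omega> by auto
  have cbox: "AE x in lebesgue. x \<in> cbox c d \<longrightarrow> g x = 0" if cd: "cbox c d \<subseteq> \<Omega>" for c d
  proof -
    \<comment> \<open>Extension by zero makes the function integrable over every box, as the
      differentiation theorem requires.\<close>
    define F where "F x = (if x \<in> cbox c d then g x else 0)" for x
    have "g integrable_on cbox c d"
      using g cd compact_cbox[of c d] unfolding locally_integrable_def
      by (intro set_lebesgue_integral_eq_integral(1)) blast
    then have "F integrable_on UNIV"
      unfolding F_def[abs_def] by (simp add: integrable_restrict_UNIV)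
    then have "F integrable_on cbox a b" for a b
      by (rule integrable_on_subcbox) simp
    then obtain N where N: "negligible N"
      and N': "\<And>x e. x \<notin> N \<Longrightarrow> 0 < e \<Longrightarrow> \<exists>\<delta>>0. \<forall>h. 0 < h \<and> h < \<delta> \<longrightarrow>
          norm (integral (cbox x (x + h *\<^sub>R One)) F /\<^sub>R h ^ DIM('a) - F x) < e"
      by (rule integrable_ccontinuous_explicit) blast
    have "g x = 0" if x: "x \<in> box c d" "x \<notin> N" for x
    proof (rule ccontr)
      assume "g x \<noteq> 0"
      with N'[OF x(2), of "norm (g x)"] obtain \<delta> where \<delta>: "\<delta> > 0" "\<And>h. 0 < h \<Longrightarrow> h < \<delta> \<Longrightarrow>
          norm (integral (cbox x (x + h *\<^sub>R One)) F /\<^sub>R h ^ DIM('a) - F x) < norm (g x)" by auto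
      \<comment> \<open>The cubes of the differentiation theorem have \<open>x\<close> as their
        lower corner, so only the distance from \<open>x\<close> to the upper faces of the box
        limits their side.\<close>
      define m where "m = Min ((\<lambda>i. d \<bullet> i - x \<bullet> i) ` Basis)"
      have m: "m > 0" "\<And>i. i \<in> Basis \<Longrightarrow> m \<le> d \<bullet> i - x \<bullet> i"
        using x(1) by (auto simp: m_def mem_box)
      define h where "h = min m (\<delta> / 2)"
      have h: "0 < h" "h < \<delta>" "h \<le> m" using m \<delta> by (auto simp: h_def)
      have sub: "cbox x (x + h *\<^sub>R One) \<subseteq> cbox c d"
      proof
        fix y assume y: "y \<in> cbox x (x + h *\<^sub>R One)"
        have "c \<bullet> i \<le> y \<bullet> i \<and> y \<bullet> i \<le> d \<bullet> i" if "i \<in> Basis" for i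
          using y x(1) m(2)[OF that] h(3) that by (force simp: mem_box inner_simps)
        then show "y \<in> cbox c d" by (simp add: mem_box)
      qed
      have "integral (cbox x (x + h *\<^sub>R One)) F = integral (cbox x (x + h *\<^sub>R One)) g"
        using sub by (intro Henstock_Kurzweil_Integration.integral_cong) (auto simp: F_def)
      also have "\<dots> = 0"
        using sub cd by (intro fundamental_lemma_box[OF \<Omega>' g 0]) auto
      finally show False
        using \<delta>(2)[OF h(1,2)] x(1) box_subset_cbox[of c d] by (auto simp: F_def)
    qed
    then have "{x. \<not> (x \<in> cbox c d \<longrightarrow> g x = 0)} \<subseteq> N \<union> (cbox c d - box c d)" by blast
    then show ?thesis
      unfolding eventually_ae_filter_negligible
      by (intro exI[of _ "N \<union> (cbox c d - box c d)"] conjI negligible_Un[OF N negligible_frontier_interval])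
  qed
  \<comment> \<open>Countably many boxes exhaust the open set, so the exceptional null sets can be
    united.\<close>
  obtain D where D: "countable D" "D \<subseteq> Pow \<Omega>" "\<And>X. X \<in> D \<Longrightarrow> \<exists>a b. X = cbox a b" "\<Union>D = \<Omega>"
  proof (rule open_countable_Union_open_cbox[OF \<Omega>])
    fix E assume "countable E" "E \<subseteq> Pow \<Omega>" "\<And>X. X \<in> E \<Longrightarrow> \<exists>a b. X = cbox a b" "\<Union>E = \<Omega>"
    then show thesis by (rule that)
  qed
  have "\<forall>X\<in>D. AE x in lebesgue. x \<in> X \<longrightarrow> g x = 0"
  proof
    fix X assume X: "X \<in> D"
    then obtain a b where "X = cbox a b" using D(3) by blast
    moreover have "X \<subseteq> \<Omega>" using X D(2) by blast
    ultimately show "AE x in lebesgue. x \<in> X \<longrightarrow> g x = 0" using cbox[of a b] by simp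
  qed
  then have "AE x in lebesgue. \<forall>X\<in>D. x \<in> X \<longrightarrow> g x = 0"
    by (subst AE_ball_countable[OF D(1)])
  then have "AE x in lebesgue. x \<in> \<Omega> \<longrightarrow> g x = 0"
    by eventually_elim (use D(4) in auto)
  then show ?thesis
    using \<Omega>' by (subst AE_restrict_space_iff) auto
qed

lemma has_weak_partial_diff:
  assumes \<Omega>: "\<Omega> \<in> sets lebesgue" and u: "has_weak_partial \<Omega> i u g" and v: "has_weak_partial \<Omega> i v h"
    and i: "i \<in> Basis"
  shows "has_weak_partial \<Omega> i (\<lambda>x. u x - v x) (\<lambda>x. g x - h x)"
  unfolding has_weak_partial_def
proof (intro conjI allI impI)
  show "locally_integrable \<Omega> (\<lambda>x. u x - v x)" "locally_integrable \<Omega> (\<lambda>x. g x - h x)"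
    using u v unfolding has_weak_partial_def locally_integrable_def by (auto intro: set_integral_diff)
  fix \<phi> assume \<phi>: "test_fun \<Omega> \<phi>"
  have L: "locally_integrable \<Omega> u" "locally_integrable \<Omega> g" "locally_integrable \<Omega> v" "locally_integrable \<Omega> h"
    using u v unfolding has_weak_partial_def by auto
  have "(LINT x|lebesgue_on \<Omega>. (u x - v x) * partial i \<phi> x)
      = (LINT x|lebesgue_on \<Omega>. u x * partial i \<phi> x) - (LINT x|lebesgue_on \<Omega>. v x * partial i \<phi> x)"
    unfolding left_diff_distrib
    by (intro Bochner_Integration.integral_diff locally_integrable_mult_test_fun[OF \<Omega>] L test_fun_partial[OF \<phi> i])
  also have "\<dots> = - ((LINT x|lebesgue_on \<Omega>. g x * \<phi> x) - (LINT x|lebesgue_on \<Omega>. h x * \<phi> x))"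
    using u v \<phi> unfolding has_weak_partial_def by simp
  also have "(LINT x|lebesgue_on \<Omega>. g x * \<phi> x) - (LINT x|lebesgue_on \<Omega>. h x * \<phi> x)
      = (LINT x|lebesgue_on \<Omega>. (g x - h x) * \<phi> x)"
    unfolding left_diff_distrib
    by (intro Bochner_Integration.integral_diff[symmetric] locally_integrable_mult_test_fun[OF \<Omega>] L \<phi>)
  finally show "(LINT x|lebesgue_on \<Omega>. (u x - v x) * partial i \<phi> x) = - (LINT x|lebesgue_on \<Omega>. (g x - h x) * \<phi> x)" .
qed

lemma has_weak_partial_unique:
  assumes \<Omega>: "open \<Omega>" and g: "has_weak_partial \<Omega> i u g" and h: "has_weak_partial \<Omega> i u h"
  shows "AE x in lebesgue_on \<Omega>. g x = h x"
proof -
  have \<Omega>': "\<Omega> \<in> sets lebesgue" using \<Omega> by auto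
  have L: "locally_integrable \<Omega> g" "locally_integrable \<Omega> h"
    using g h unfolding has_weak_partial_def by auto
  have "AE x in lebesgue_on \<Omega>. g x - h x = 0"
  proof (rule fundamental_lemma[OF \<Omega>])
    show "locally_integrable \<Omega> (\<lambda>x. g x - h x)"
      using L unfolding locally_integrable_def by (auto intro: set_integral_diff)
    fix \<phi> assume \<phi>: "test_fun \<Omega> \<phi>"
    have "(LINT x|lebesgue_on \<Omega>. (g x - h x) * \<phi> x)
        = (LINT x|lebesgue_on \<Omega>. g x * \<phi> x) - (LINT x|lebesgue_on \<Omega>. h x * \<phi> x)"
      unfolding left_diff_distrib
      by (intro Bochner_Integration.integral_diff locally_integrable_mult_test_fun[OF \<Omega>'] L \<phi>)
    then show "(LINT x|lebesgue_on \<Omega>. (g x - h x) * \<phi> x) = 0"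
      using g h \<phi> unfolding has_weak_partial_def by auto
  qed
  then show ?thesis by simp
qed

text \<open>Once some weak derivative exists, the one picked by \<open>SOME\<close> is a weak
  derivative too, and uniqueness applies.\<close>

lemma weak_partial_AE_eq:
  assumes "open \<Omega>" "has_weak_partial \<Omega> i u g"
  shows "AE x in lebesgue_on \<Omega>. weak_partial \<Omega> i u x = g x"
  using has_weak_partial_unique[OF assms(1) _ assms(2)] someI[of "has_weak_partial \<Omega> i u", OF assms(2)]
  unfolding weak_partial_def by blast

text \<open>Completeness of Lebesgue measure. It supplies measurability of functions such as
  \<open>weak_grad\<close>, which are known only up to a null set.\<close>

lemma borel_measurable_lebesgue_on_AE:
  fixes f g :: "'a::euclidean_space \<Rightarrow> 'b::euclidean_space"
  assumes \<Omega>: "\<Omega> \<in> sets lebesgue" and f: "f \<in> borel_measurable (lebesgue_on \<Omega>)"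
    and eq: "AE x in lebesgue_on \<Omega>. f x = g x"
  shows "g \<in> borel_measurable (lebesgue_on \<Omega>)"
proof -
  have "(\<lambda>x. indicator \<Omega> x *\<^sub>R f x) \<in> borel_measurable lebesgue"
    using f \<Omega> by (subst (asm) borel_measurable_restrict_space_iff) auto
  moreover have "AE x in lebesgue. indicator \<Omega> x *\<^sub>R f x = indicator \<Omega> x *\<^sub>R g x"
    using eq \<Omega> by (subst (asm) AE_restrict_space_iff) (auto elim!: AE_mp)
  ultimately have "(\<lambda>x. indicator \<Omega> x *\<^sub>R g x) \<in> borel_measurable lebesgue"
    by (rule borel_measurable_AE)
  then show ?thesis
    using \<Omega> by (subst borel_measurable_restrict_space_iff) auto
qed

lemma weak_grad_AE_eq:
  assumes "open \<Omega>" "\<And>i. i \<in> Basis \<Longrightarrow> has_weak_partial \<Omega> i u (\<lambda>x. g x \<bullet> i)"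
  shows "AE x in lebesgue_on \<Omega>. weak_grad \<Omega> u x = g x"
proof -
  have "AE x in lebesgue_on \<Omega>. \<forall>i\<in>Basis. weak_partial \<Omega> i u x = g x \<bullet> i"
    using weak_partial_AE_eq[OF assms(1)] assms(2) by (intro AE_ball_countable[THEN iffD2]) (auto intro: countable_finite)
  then show ?thesis
    by eventually_elim (simp add: weak_grad_def euclidean_representation)
qed

section \<open>The space of functions with zero trace\<close>

text \<open>Integrability is asked of the majorants alone: should some \<open>f n\<close> fail to be
  integrable, its integral is 0 by convention and the squeeze still works.\<close>

lemma integral_tendsto_0_squeeze:
  fixes f b :: "nat \<Rightarrow> 'a \<Rightarrow> real"
  assumes "\<And>n. integrable M (b n)" "\<And>n x. x \<in> space M \<Longrightarrow> 0 \<le> f n x" "\<And>n x. x \<in> space M \<Longrightarrow> f n x \<le> b n x"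
    and "(\<lambda>n. LINT x|M. b n x) \<longlonglongrightarrow> 0"
  shows "(\<lambda>n. LINT x|M. f n x) \<longlonglongrightarrow> 0"
proof (rule tendsto_sandwich[OF _ _ tendsto_const assms(4)])
  show "\<forall>\<^sub>F n in sequentially. 0 \<le> (LINT x|M. f n x)"
    using assms(2) by (intro always_eventually allI integral_nonneg_AE AE_I2)
  show "\<forall>\<^sub>F n in sequentially. (LINT x|M. f n x) \<le> (LINT x|M. b n x)"
    using assms(1-3) by (intro always_eventually allI integral_mono') (blast intro: order_trans)+
qed

text \<open>\<open>H0_pair \<Omega> u g\<close> says that \<open>u \<in> H\<^sup>1\<^sub>0(\<Omega>)\<close> and \<open>g = \<nabla>u\<close>, in a form that does not
  depend on the choice of representatives made by \<open>weak_grad\<close>.\<close>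

definition H0_pair :: "'a::euclidean_space set \<Rightarrow> ('a \<Rightarrow> real) \<Rightarrow> ('a \<Rightarrow> 'a) \<Rightarrow> bool" where
  "H0_pair \<Omega> u g \<longleftrightarrow> square_integrable (lebesgue_on \<Omega>) u \<and> square_integrable (lebesgue_on \<Omega>) g \<and>
     (\<exists>\<phi>. (\<forall>n::nat. test_fun \<Omega> (\<phi> n)) \<and>
       (\<lambda>n. LINT x|lebesgue_on \<Omega>. (norm (\<phi> n x - u x))\<^sup>2) \<longlonglongrightarrow> 0 \<and>
       (\<lambda>n. LINT x|lebesgue_on \<Omega>. (norm (gradient (\<phi> n) x - g x))\<^sup>2) \<longlonglongrightarrow> 0)"

lemma L2_iff_square_integrable: "u \<in> L2 \<Omega> \<longleftrightarrow> square_integrable (lebesgue_on \<Omega>) u"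
  by (simp add: L2_def square_integrable_def)

locale bounded_open =
  fixes \<Omega> :: "'a::euclidean_space set"
  assumes open_domain: "open \<Omega>" and bounded_domain: "bounded \<Omega>"
begin

abbreviation M :: "'a measure" where "M \<equiv> lebesgue_on \<Omega>"

lemma sets_domain: "\<Omega> \<in> sets lebesgue"
  using open_domain by auto

lemma finite_measure_domain: "finite_measure M"
  by (intro finite_measure_lebesgue_on bounded_set_imp_lmeasurable bounded_domain sets_domain)

lemma square_integrable_imp_integrable:
  fixes f :: "'a \<Rightarrow> 'b::euclidean_space"
  assumes "square_integrable M f"
  shows "integrable M f"
  using integrable_norm_mult[OF assms square_integrable_const[OF finite_measure_domain, where c="1::real"]]
  by (intro integrable_norm_cancel[of M f]) (auto intro: square_integrable_measurable[OF assms])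

lemma square_integrable_imp_locally_integrable:
  assumes "square_integrable M f"
  shows "locally_integrable \<Omega> f"
  unfolding locally_integrable_def
proof (intro allI impI)
  fix K assume K: "compact K \<and> K \<subseteq> \<Omega>"
  have "f absolutely_integrable_on \<Omega>"
    using square_integrable_imp_integrable[OF assms] sets_domain
    by (subst (asm) integrable_restrict_space) (auto simp: set_integrable_def)
  then show "f absolutely_integrable_on K"
    by (rule set_integrable_subset) (use K in \<open>auto simp: compact_imp_closed\<close>)
qed

lemma square_integrable_test_fun:
  assumes "test_fun \<Omega> \<phi>"
  shows "square_integrable M \<phi>"
proof -
  obtain C where "\<And>x. \<bar>\<phi> x\<bar> \<le> C" using test_fun_bounded[OF assms] by blast
  then show ?thesis
    by (intro square_integrable_bounded[where C=C] finite_measure_domain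
        continuous_imp_measurable_on_sets_lebesgue test_fun_continuous[OF assms] sets_domain) auto
qed

lemma square_integrable_gradient:
  assumes "test_fun \<Omega> \<phi>"
  shows "square_integrable M (gradient \<phi>)"
proof -
  obtain C where "\<And>x. norm (gradient \<phi> x) \<le> C" using gradient_bounded[OF assms] by blast
  then show ?thesis
    by (intro square_integrable_bounded[where C=C] finite_measure_domain
        continuous_imp_measurable_on_sets_lebesgue continuous_on_gradient[OF assms] sets_domain) auto
qed

lemmas square_integrable_simps =
  square_integrable_test_fun square_integrable_gradient square_integrable_diff

lemma square_integrable_component:
  assumes "square_integrable M g" "i \<in> Basis"
  shows "square_integrable M (\<lambda>x. g x \<bullet> i)"
proof (rule square_integrable_bound[OF assms(1), where C=1])
  show "(\<lambda>x. g x \<bullet> i) \<in> borel_measurable M"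
    using square_integrable_measurable[OF assms(1)] by measurable
qed (use assms(2) in \<open>auto simp: Basis_le_norm\<close>)

lemma has_weak_partial_test_fun:
  assumes \<phi>: "test_fun \<Omega> \<phi>" and i: "i \<in> Basis"
  shows "has_weak_partial \<Omega> i \<phi> (\<lambda>x. gradient \<phi> x \<bullet> i)"
  unfolding has_weak_partial_def gradient_inner_Basis[OF i]
  using integral_by_parts_test_fun[OF sets_domain _ test_fun_Ck[OF \<phi>] i]
  by (auto intro!: square_integrable_imp_locally_integrable square_integrable_test_fun test_fun_partial \<phi> i)

text \<open>Integration by parts holds for the approximating test functions. Each side pairs them,
  or their gradients, with a fixed square integrable function, so the identity survives the limit in
  L2.\<close>

lemma H0_pair_has_weak_partial:
  assumes "H0_pair \<Omega> u g" and i: "i \<in> Basis"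
  shows "has_weak_partial \<Omega> i u (\<lambda>x. g x \<bullet> i)"
proof -
  obtain \<phi> where u: "square_integrable M u" and g: "square_integrable M g" and \<phi>: "\<And>n. test_fun \<Omega> (\<phi> n)"
    and lim: "(\<lambda>n. LINT x|M. (norm (\<phi> n x - u x))\<^sup>2) \<longlonglongrightarrow> 0"
      "(\<lambda>n. LINT x|M. (norm (gradient (\<phi> n) x - g x))\<^sup>2) \<longlonglongrightarrow> 0"
    using assms(1) unfolding H0_pair_def by blast
  have "(LINT x|M. u x * partial i \<psi> x) = - (LINT x|M. (g x \<bullet> i) * \<psi> x)" if \<psi>: "test_fun \<Omega> \<psi>" for \<psi>
  proof -
    have 1: "(\<lambda>n. LINT x|M. partial i \<psi> x \<bullet> \<phi> n x) \<longlonglongrightarrow> (LINT x|M. partial i \<psi> x \<bullet> u x)"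
      by (intro tendsto_integral_inner square_integrable_test_fun test_fun_partial \<psi> i \<phi> u lim)
    \<comment> \<open>Testing the i-th component of a field with \<psi> is the inner product of that
      field with \<psi> times the basis vector \<open>i\<close>, the form to which L2 convergence of
      the gradients applies.\<close>
    have \<psi>i: "square_integrable M (\<lambda>x. \<psi> x *\<^sub>R i)"
    proof (rule square_integrable_bound[OF square_integrable_test_fun[OF \<psi>], where C=1])
      show "(\<lambda>x. \<psi> x *\<^sub>R i) \<in> borel_measurable M"
        using square_integrable_measurable[OF square_integrable_test_fun[OF \<psi>]] by measurable
    qed (use i in auto)
    have 2: "(\<lambda>n. LINT x|M. (\<psi> x *\<^sub>R i) \<bullet> gradient (\<phi> n) x) \<longlonglongrightarrow> (LINT x|M. (\<psi> x *\<^sub>R i) \<bullet> g x)"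
      by (intro tendsto_integral_inner \<psi>i square_integrable_gradient \<phi> g lim)
    have "(LINT x|M. partial i \<psi> x \<bullet> \<phi> n x) = - (LINT x|M. (\<psi> x *\<^sub>R i) \<bullet> gradient (\<phi> n) x)" for n
      using has_weak_partial_test_fun[OF \<phi>[of n] i] \<psi>
      unfolding has_weak_partial_def by (simp add: mult.commute inner_commute)
    then have "(\<lambda>n. - (LINT x|M. (\<psi> x *\<^sub>R i) \<bullet> gradient (\<phi> n) x)) \<longlonglongrightarrow> (LINT x|M. partial i \<psi> x \<bullet> u x)"
      using 1 by simp
    from LIMSEQ_unique[OF this tendsto_minus[OF 2]] show ?thesis
      by (simp add: mult.commute inner_commute)
  qed
  then show ?thesis
    unfolding has_weak_partial_def
    by (auto intro!: square_integrable_imp_locally_integrable square_integrable_component u g i)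
qed

lemma weak_grad_test_fun_diff:
  assumes "test_fun \<Omega> \<phi>" "\<And>i. i \<in> Basis \<Longrightarrow> has_weak_partial \<Omega> i u (\<lambda>x. g x \<bullet> i)"
  shows "AE x in M. weak_grad \<Omega> (\<lambda>x. \<phi> x - u x) x = gradient \<phi> x - g x"
proof (rule weak_grad_AE_eq[OF open_domain])
  fix i :: 'a assume i: "i \<in> Basis"
  show "has_weak_partial \<Omega> i (\<lambda>x. \<phi> x - u x) (\<lambda>x. (gradient \<phi> x - g x) \<bullet> i)"
    unfolding inner_diff_left
    by (rule has_weak_partial_diff[OF sets_domain has_weak_partial_test_fun[OF assms(1) i] assms(2)[OF i] i])
qed

text \<open>Frees the norm occurring in \<open>H10\<close> from the chosen representative:
  \<open>weak_grad\<close> of the difference may be replaced under the integral by the explicit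
  field.\<close>

lemma H1_norm_test_fun_diff:
  assumes "test_fun \<Omega> \<phi>" "\<And>i. i \<in> Basis \<Longrightarrow> has_weak_partial \<Omega> i u (\<lambda>x. g x \<bullet> i)"
    and "square_integrable M g"
  shows "H1_norm \<Omega> (\<lambda>x. \<phi> x - u x)
    = sqrt ((LINT x|M. (norm (\<phi> x - u x))\<^sup>2) + (LINT x|M. (norm (gradient \<phi> x - g x))\<^sup>2))"
proof -
  have AE: "AE x in M. weak_grad \<Omega> (\<lambda>x. \<phi> x - u x) x = gradient \<phi> x - g x"
    by (rule weak_grad_test_fun_diff[OF assms(1,2)])
  have m: "(\<lambda>x. gradient \<phi> x - g x) \<in> borel_measurable M"
    using assms by (intro square_integrable_measurable square_integrable_simps)
  have m': "weak_grad \<Omega> (\<lambda>x. \<phi> x - u x) \<in> borel_measurable M"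
    by (rule borel_measurable_lebesgue_on_AE[OF sets_domain m]) (use AE in eventually_elim, simp)
  have "(LINT x|M. (norm (weak_grad \<Omega> (\<lambda>x. \<phi> x - u x) x))\<^sup>2) = (LINT x|M. (norm (gradient \<phi> x - g x))\<^sup>2)"
  proof (rule integral_cong_AE)
    show "AE x in M. (norm (weak_grad \<Omega> (\<lambda>x. \<phi> x - u x) x))\<^sup>2 = (norm (gradient \<phi> x - g x))\<^sup>2"
      using AE by eventually_elim simp
  qed (use m m' in measurable)
  then show ?thesis by (simp add: H1_norm_def)
qed

text \<open>The limit field is a weak gradient of \<open>u\<close>, so by uniqueness the chosen one
  agrees with it off a null set, and the two notions of convergence coincide.\<close>

lemma H0_pair_imp_H10:
  assumes "H0_pair \<Omega> u g"
  shows "u \<in> H10 \<Omega>" "AE x in M. weak_grad \<Omega> u x = g x"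
proof -
  note W = H0_pair_has_weak_partial[OF assms]
  obtain \<phi> where u: "square_integrable M u" and g: "square_integrable M g" and \<phi>: "\<And>n. test_fun \<Omega> (\<phi> n)"
    and lim: "(\<lambda>n. LINT x|M. (norm (\<phi> n x - u x))\<^sup>2) \<longlonglongrightarrow> 0"
      "(\<lambda>n. LINT x|M. (norm (gradient (\<phi> n) x - g x))\<^sup>2) \<longlonglongrightarrow> 0"
    using assms(1) unfolding H0_pair_def by blast
  show "AE x in M. weak_grad \<Omega> u x = g x"
    by (rule weak_grad_AE_eq[OF open_domain W])
  have H1: "u \<in> H1 \<Omega>"
    unfolding H1_def L2_iff_square_integrable Bex_def
  proof (intro CollectI conjI ballI)
    fix i :: 'a assume "i \<in> Basis"
    then show "\<exists>h. square_integrable M h \<and> has_weak_partial \<Omega> i u h"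
      using W square_integrable_component[OF g] by (intro exI[of _ "\<lambda>x. g x \<bullet> i"] conjI)
  qed (rule u)
  have norm: "H1_norm \<Omega> (\<lambda>x. \<phi> n x - u x)
      = sqrt ((LINT x|M. (norm (\<phi> n x - u x))\<^sup>2) + (LINT x|M. (norm (gradient (\<phi> n) x - g x))\<^sup>2))" for n
    by (rule H1_norm_test_fun_diff[OF \<phi> W g])
  have "(\<lambda>n. H1_norm \<Omega> (\<lambda>x. \<phi> n x - u x)) \<longlonglongrightarrow> 0"
    unfolding norm using tendsto_real_sqrt[OF tendsto_add[OF lim]] by simp
  then show "u \<in> H10 \<Omega>" unfolding H10_def using H1 \<phi> by blast
qed

lemma H0_pair_AE:
  assumes "H0_pair \<Omega> u g" and eq: "AE x in M. g x = h x"
  shows "H0_pair \<Omega> u h"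
proof -
  have g: "square_integrable M g" using assms(1) by (simp add: H0_pair_def)
  have hm: "h \<in> borel_measurable M"
    by (rule borel_measurable_lebesgue_on_AE[OF sets_domain square_integrable_measurable[OF g] eq])
  have h: "square_integrable M h"
    by (rule square_integrable_AE[OF g hm eq])
  have eq': "(LINT x|M. (norm (gradient \<phi> x - h x))\<^sup>2) = (LINT x|M. (norm (gradient \<phi> x - g x))\<^sup>2)" if "test_fun \<Omega> \<phi>" for \<phi>
  proof (rule integral_cong_AE)
    show "(\<lambda>x. (norm (gradient \<phi> x - h x))\<^sup>2) \<in> borel_measurable M" "(\<lambda>x. (norm (gradient \<phi> x - g x))\<^sup>2) \<in> borel_measurable M"
      using square_integrable_simps(2)[OF that] g h
      by (auto intro!: borel_measurable_integrable square_integrableD square_integrable_diff)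
    show "AE x in M. (norm (gradient \<phi> x - h x))\<^sup>2 = (norm (gradient \<phi> x - g x))\<^sup>2"
      using eq by eventually_elim simp
  qed
  obtain \<phi> where u: "square_integrable M u" and \<phi>: "\<And>n. test_fun \<Omega> (\<phi> n)"
    and lim: "(\<lambda>n. LINT x|M. (norm (\<phi> n x - u x))\<^sup>2) \<longlonglongrightarrow> 0"
      "(\<lambda>n. LINT x|M. (norm (gradient (\<phi> n) x - g x))\<^sup>2) \<longlonglongrightarrow> 0"
    using assms(1) unfolding H0_pair_def by blast
  from lim(2) have "(\<lambda>n. LINT x|M. (norm (gradient (\<phi> n) x - h x))\<^sup>2) \<longlonglongrightarrow> 0"
    unfolding eq'[OF \<phi>] .
  then show ?thesis
    unfolding H0_pair_def using u h \<phi> lim(1) by blast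
qed

text \<open>The derivative chosen by \<open>weak_partial\<close> is not known in advance to be the
  square integrable one that \<open>H1\<close> provides. The argument therefore runs with the
  latter, assembled into the field \<open>g\<close>, and exchanges \<open>g\<close> for
  \<open>weak_grad\<close> only at the end.\<close>

lemma H10_imp_H0_pair:
  assumes "u \<in> H10 \<Omega>"
  shows "H0_pair \<Omega> u (weak_grad \<Omega> u)"
proof -
  have u: "square_integrable M u"
    using assms by (simp add: H10_def H1_def L2_iff_square_integrable)
  have "\<forall>i\<in>Basis. \<exists>g. square_integrable M g \<and> has_weak_partial \<Omega> i u g"
    using assms unfolding H10_def H1_def L2_iff_square_integrable Bex_def by blast
  then obtain G where G: "\<And>i. i \<in> Basis \<Longrightarrow> square_integrable M (G i) \<and> has_weak_partial \<Omega> i u (G i)"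
    using bchoice[of Basis "\<lambda>i g. square_integrable M g \<and> has_weak_partial \<Omega> i u g"] by blast
  define g where "g x = (\<Sum>i\<in>Basis. G i x *\<^sub>R i)" for x
  have gi: "g x \<bullet> i = G i x" if "i \<in> Basis" for x i
    using that by (simp add: g_def inner_sum_left inner_Basis if_distrib cong: if_cong)
  have "g \<in> borel_measurable M"
    unfolding g_def[abs_def] using G
    by (intro borel_measurable_sum borel_measurable_scaleR) (auto intro: square_integrable_measurable)
  moreover have "integrable M (\<lambda>x. \<Sum>i\<in>Basis. (norm (G i x))\<^sup>2)"
    using G by (intro Bochner_Integration.integrable_sum square_integrableD) auto
  moreover have "(norm (g x))\<^sup>2 = (\<Sum>i\<in>Basis. (norm (G i x))\<^sup>2)" for x
    unfolding power2_norm_eq_inner euclidean_inner[of "g x" "g x"] by (intro sum.cong) (auto simp: gi)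
  ultimately have g: "square_integrable M g" by (simp add: square_integrable_def)
  have W: "has_weak_partial \<Omega> i u (\<lambda>x. g x \<bullet> i)" if "i \<in> Basis" for i
    using G[OF that] gi[OF that] by simp
  obtain \<phi> where \<phi>: "\<And>n::nat. test_fun \<Omega> (\<phi> n)" and lim: "(\<lambda>n. H1_norm \<Omega> (\<lambda>x. \<phi> n x - u x)) \<longlonglongrightarrow> 0"
    using assms unfolding H10_def by blast
  define p where "p n = (LINT x|M. (norm (\<phi> n x - u x))\<^sup>2)" for n
  define q where "q n = (LINT x|M. (norm (gradient (\<phi> n) x - g x))\<^sup>2)" for n
  have pq: "0 \<le> p n" "0 \<le> q n" for n unfolding p_def q_def by (auto intro!: integral_nonneg_AE)
  have norm: "H1_norm \<Omega> (\<lambda>x. \<phi> n x - u x)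
      = sqrt ((LINT x|M. (norm (\<phi> n x - u x))\<^sup>2) + (LINT x|M. (norm (gradient (\<phi> n) x - g x))\<^sup>2))" for n
    by (rule H1_norm_test_fun_diff[OF \<phi> W g])
  have "(\<lambda>n. (sqrt (p n + q n))\<^sup>2) \<longlonglongrightarrow> 0\<^sup>2"
    using lim unfolding norm p_def[symmetric] q_def[symmetric]
    by (rule tendsto_power)
  then have pq0: "(\<lambda>n. p n + q n) \<longlonglongrightarrow> 0" using pq by simp
  have "p \<longlonglongrightarrow> 0"
    by (rule tendsto_sandwich[OF _ _ tendsto_const pq0]) (use pq in auto)
  moreover have "q \<longlonglongrightarrow> 0"
    by (rule tendsto_sandwich[OF _ _ tendsto_const pq0]) (use pq in auto)
  ultimately have "H0_pair \<Omega> u g"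
    unfolding H0_pair_def using u g \<phi> unfolding p_def[abs_def] q_def[abs_def] by blast
  moreover have "AE x in M. weak_grad \<Omega> u x = g x"
    by (rule weak_grad_AE_eq[OF open_domain W])
  then have "AE x in M. g x = weak_grad \<Omega> u x" by eventually_elim simp
  ultimately show ?thesis by (rule H0_pair_AE)
qed

lemma H0_pair_diff:
  assumes "H0_pair \<Omega> u g" "H0_pair \<Omega> v h"
  shows "H0_pair \<Omega> (\<lambda>x. u x - v x) (\<lambda>x. g x - h x)"
proof -
  obtain \<phi> where u: "square_integrable M u" and g: "square_integrable M g" and \<phi>: "\<And>n. test_fun \<Omega> (\<phi> n)"
    and lim: "(\<lambda>n. LINT x|M. (norm (\<phi> n x - u x))\<^sup>2) \<longlonglongrightarrow> 0"
      "(\<lambda>n. LINT x|M. (norm (gradient (\<phi> n) x - g x))\<^sup>2) \<longlonglongrightarrow> 0"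
    using assms(1) unfolding H0_pair_def by blast
  obtain \<psi> where v: "square_integrable M v" and h: "square_integrable M h" and \<psi>: "\<And>n. test_fun \<Omega> (\<psi> n)"
    and lim': "(\<lambda>n. LINT x|M. (norm (\<psi> n x - v x))\<^sup>2) \<longlonglongrightarrow> 0"
      "(\<lambda>n. LINT x|M. (norm (gradient (\<psi> n) x - h x))\<^sup>2) \<longlonglongrightarrow> 0"
    using assms(2) unfolding H0_pair_def by blast
  \<comment> \<open>Stated for values in any Euclidean space, so that it serves both the functions
    and their gradients.\<close>
  have sum: "(\<lambda>n. LINT x|M. (norm ((a n x - c n x) - (b x - d x)))\<^sup>2) \<longlonglongrightarrow> 0"
    if i: "\<And>n. square_integrable M (a n)" "\<And>n. square_integrable M (c n)" "square_integrable M b" "square_integrable M d"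
      and l: "(\<lambda>n. LINT x|M. (norm (a n x - b x))\<^sup>2) \<longlonglongrightarrow> 0" "(\<lambda>n. LINT x|M. (norm (c n x - d x))\<^sup>2) \<longlonglongrightarrow> 0"
    for a c :: "nat \<Rightarrow> 'a \<Rightarrow> 'b::euclidean_space" and b d
  proof (rule integral_tendsto_0_squeeze)
    show "integrable M (\<lambda>x. 2 * (norm (a n x - b x))\<^sup>2 + 2 * (norm (c n x - d x))\<^sup>2)" for n
      by (intro Bochner_Integration.integrable_add integrable_mult_right square_integrableD square_integrable_diff i)
    have "(\<lambda>n. 2 * (LINT x|M. (norm (a n x - b x))\<^sup>2) + 2 * (LINT x|M. (norm (c n x - d x))\<^sup>2)) \<longlonglongrightarrow> 2 * 0 + 2 * 0"
      by (intro tendsto_add tendsto_mult_left l)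
    moreover have "(LINT x|M. 2 * (norm (a n x - b x))\<^sup>2 + 2 * (norm (c n x - d x))\<^sup>2)
        = 2 * (LINT x|M. (norm (a n x - b x))\<^sup>2) + 2 * (LINT x|M. (norm (c n x - d x))\<^sup>2)" for n
      by (subst Bochner_Integration.integral_add)
        (auto intro!: integrable_mult_right square_integrableD square_integrable_diff i)
    ultimately show "(\<lambda>n. LINT x|M. 2 * (norm (a n x - b x))\<^sup>2 + 2 * (norm (c n x - d x))\<^sup>2) \<longlonglongrightarrow> 0"
      by simp
    show "(norm (a n x - c n x - (b x - d x)))\<^sup>2 \<le> 2 * (norm (a n x - b x))\<^sup>2 + 2 * (norm (c n x - d x))\<^sup>2" for n x
      using norm_add_sq_le[of "a n x - b x" "d x - c n x"] by (simp add: algebra_simps norm_minus_commute)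
  qed simp
  have eq: "gradient (\<lambda>x. \<phi> n x - \<psi> n x) x = gradient (\<phi> n) x - gradient (\<psi> n) x" for n x
    by (intro gradient_diff test_fun_differentiable[OF \<phi>] test_fun_differentiable[OF \<psi>])
  show ?thesis
    unfolding H0_pair_def
  proof (intro conjI exI[of _ "\<lambda>n x. \<phi> n x - \<psi> n x"] allI)
    show "(\<lambda>n. LINT x|M. (norm (gradient (\<lambda>x. \<phi> n x - \<psi> n x) x - (g x - h x)))\<^sup>2) \<longlonglongrightarrow> 0"
      unfolding eq by (intro sum square_integrable_gradient \<phi> \<psi> g h lim lim')
    show "(\<lambda>n. LINT x|M. (norm (\<phi> n x - \<psi> n x - (u x - v x)))\<^sup>2) \<longlonglongrightarrow> 0"
      by (intro sum square_integrable_test_fun \<phi> \<psi> u v lim lim')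
  qed (intro square_integrable_diff u v g h test_fun_diff \<phi> \<psi>)+
qed

section \<open>The Poincare inequality\<close>

text \<open>With y the product of the coordinate \<open>x \<bullet> i\<close> and the i-th partial
  derivative of \<phi>, the product of \<phi> and that coordinate has i-th partial derivative \<phi>
  + y. Integration by parts against \<phi> shows that the integral of \<phi>^2 equals that of -2
  \<phi> y. Expanding (\<phi> + 2y)^2 >= 0 bounds this integrand by \<phi>^2/2 + 2 y^2; absorbing
  the half on the left doubles the factor 2 R^2 to 4 R^2.\<close>

lemma Poincare_test_fun:
  assumes \<phi>: "test_fun \<Omega> \<phi>" and R: "\<And>x. x \<in> \<Omega> \<Longrightarrow> norm x \<le> R"
  shows "(LINT x|M. (norm (\<phi> x))\<^sup>2) \<le> 4 * R\<^sup>2 * (LINT x|M. (norm (gradient \<phi> x))\<^sup>2)"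
proof -
  obtain i :: 'a where i: "i \<in> Basis" using nonempty_Basis by blast
  have Ck: "Ck k (\<lambda>x. \<phi> x * (x \<bullet> i))" for k by (intro Ck_mult Ck_inner test_fun_Ck[OF \<phi>])
  have "partial i (\<lambda>x. \<phi> x * (x \<bullet> i)) x = \<phi> x + partial i \<phi> x * (x \<bullet> i)" for x
  proof -
    have "((\<lambda>x. x \<bullet> i) has_derivative (\<lambda>h. h \<bullet> i)) (at x)" by (auto intro!: derivative_eq_intros)
    from partial_eqI[OF this, of i] show ?thesis
      using partial_mult[of \<phi> x "\<lambda>x. x \<bullet> i" i, OF test_fun_differentiable[OF \<phi>] Ck_differentiable[OF Ck_inner]] i by simp
  qed
  then have "(LINT x|M. (\<phi> x * (x \<bullet> i)) * partial i \<phi> x) = - (LINT x|M. (\<phi> x + partial i \<phi> x * (x \<bullet> i)) * \<phi> x)"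
    using integral_by_parts_test_fun[OF sets_domain \<phi> Ck i] by simp
  also have "(LINT x|M. (\<phi> x + partial i \<phi> x * (x \<bullet> i)) * \<phi> x)
      = (LINT x|M. (norm (\<phi> x))\<^sup>2 + (\<phi> x * (x \<bullet> i)) * partial i \<phi> x)"
    by (simp add: algebra_simps power2_eq_square)
  also have "\<dots> = (LINT x|M. (norm (\<phi> x))\<^sup>2) + (LINT x|M. (\<phi> x * (x \<bullet> i)) * partial i \<phi> x)"
    by (intro Bochner_Integration.integral_add square_integrableD integrable_mult_square_integrable
        square_integrable_test_fun test_fun_partial test_fun_mult \<phi> Ck_inner i)
  finally have "(LINT x|M. (norm (\<phi> x))\<^sup>2) = - 2 * (LINT x|M. (\<phi> x * (x \<bullet> i)) * partial i \<phi> x)" by simp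
  also have "\<dots> = (LINT x|M. - 2 * ((\<phi> x * (x \<bullet> i)) * partial i \<phi> x))" by simp
  also have "\<dots> \<le> (LINT x|M. (norm (\<phi> x))\<^sup>2 / 2 + 2 * R\<^sup>2 * (norm (gradient \<phi> x))\<^sup>2)"
  proof (rule integral_mono)
    show "integrable M (\<lambda>x. - 2 * ((\<phi> x * (x \<bullet> i)) * partial i \<phi> x))"
      by (intro integrable_mult_right integrable_mult_square_integrable
        square_integrable_test_fun test_fun_partial test_fun_mult \<phi> Ck_inner i)
    show "integrable M (\<lambda>x. (norm (\<phi> x))\<^sup>2 / 2 + 2 * R\<^sup>2 * (norm (gradient \<phi> x))\<^sup>2)"
      by (intro Bochner_Integration.integrable_add integrable_divide integrable_mult_right square_integrableD
        square_integrable_test_fun square_integrable_gradient \<phi>)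
    fix x assume "x \<in> space M"
    then have x: "norm x \<le> R" using R by simp
    have "\<bar>x \<bullet> i\<bar> * \<bar>partial i \<phi> x\<bar> \<le> R * norm (gradient \<phi> x)"
    proof (intro mult_mono)
      show "\<bar>x \<bullet> i\<bar> \<le> R" using Basis_le_norm[OF i, of x] x by simp
      show "\<bar>partial i \<phi> x\<bar> \<le> norm (gradient \<phi> x)"
        using Basis_le_norm[OF i, of "gradient \<phi> x"] by (simp add: gradient_inner_Basis[OF i])
    qed (use order_trans[OF norm_ge_zero x] in auto)
    then have "((x \<bullet> i) * partial i \<phi> x)\<^sup>2 \<le> (R * norm (gradient \<phi> x))\<^sup>2"
      by (metis abs_ge_zero abs_mult power2_abs power_mono)
    moreover have "0 \<le> (\<phi> x + 2 * ((x \<bullet> i) * partial i \<phi> x))\<^sup>2" by simp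
    ultimately show "- 2 * ((\<phi> x * (x \<bullet> i)) * partial i \<phi> x) \<le> (norm (\<phi> x))\<^sup>2 / 2 + 2 * R\<^sup>2 * (norm (gradient \<phi> x))\<^sup>2"
      by (simp add: power2_sum power_mult_distrib algebra_simps)
  qed
  also have "\<dots> = (LINT x|M. (norm (\<phi> x))\<^sup>2) / 2 + 2 * R\<^sup>2 * (LINT x|M. (norm (gradient \<phi> x))\<^sup>2)"
    using square_integrableD[OF square_integrable_test_fun[OF \<phi>]] square_integrableD[OF square_integrable_gradient[OF \<phi>]]
    by (subst Bochner_Integration.integral_add) auto
  finally show ?thesis by simp
qed

text \<open>The gradients of the approximating test functions tend to 0, so by the Poincare
  inequality these functions tend to 0 as well, while their limit is \<open>u\<close>.\<close>

lemma H0_pair_gradient_0: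
  assumes "H0_pair \<Omega> u g" "AE x in M. g x = 0"
  shows "AE x in M. u x = 0"
proof -
  obtain \<phi> where u: "square_integrable M u" and \<phi>: "\<And>n. test_fun \<Omega> (\<phi> n)"
    and lim: "(\<lambda>n. LINT x|M. (norm (\<phi> n x - u x))\<^sup>2) \<longlonglongrightarrow> 0"
      "(\<lambda>n. LINT x|M. (norm (gradient (\<phi> n) x))\<^sup>2) \<longlonglongrightarrow> 0"
    using H0_pair_AE[OF assms] unfolding H0_pair_def by auto
  obtain R where R: "\<And>x. x \<in> \<Omega> \<Longrightarrow> norm x \<le> R"
    using bounded_domain unfolding bounded_iff by blast
  have "(\<lambda>n. LINT x|M. (norm (\<phi> n x))\<^sup>2) \<longlonglongrightarrow> 0"
  proof (rule tendsto_sandwich[OF _ _ tendsto_const])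
    show "\<forall>\<^sub>F n in sequentially. (LINT x|M. (norm (\<phi> n x))\<^sup>2) \<le> 4 * R\<^sup>2 * (LINT x|M. (norm (gradient (\<phi> n) x))\<^sup>2)"
      by (intro always_eventually allI Poincare_test_fun \<phi> R)
    show "(\<lambda>n. 4 * R\<^sup>2 * (LINT x|M. (norm (gradient (\<phi> n) x))\<^sup>2)) \<longlonglongrightarrow> 0"
      using tendsto_mult_right_zero[OF lim(2)] by simp
  qed (auto intro!: always_eventually integral_nonneg_AE)
  then have "(\<lambda>n. 2 * (LINT x|M. (norm (\<phi> n x - u x))\<^sup>2) + 2 * (LINT x|M. (norm (\<phi> n x))\<^sup>2)) \<longlonglongrightarrow> 2 * 0 + 2 * 0"
    by (intro tendsto_add tendsto_mult_left lim)
  moreover have "(LINT x|M. (norm (u x))\<^sup>2) \<le> 2 * (LINT x|M. (norm (\<phi> n x - u x))\<^sup>2) + 2 * (LINT x|M. (norm (\<phi> n x))\<^sup>2)" for n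
  proof -
    have I: "integrable M (\<lambda>x. 2 * (norm (\<phi> n x - u x))\<^sup>2)" "integrable M (\<lambda>x. 2 * (norm (\<phi> n x))\<^sup>2)"
      by (intro integrable_mult_right square_integrableD square_integrable_diff square_integrable_test_fun \<phi> u)+
    have "(LINT x|M. (norm (u x))\<^sup>2) \<le> (LINT x|M. 2 * (norm (\<phi> n x - u x))\<^sup>2 + 2 * (norm (\<phi> n x))\<^sup>2)"
    proof (intro integral_mono square_integrableD u Bochner_Integration.integrable_add I)
      show "(norm (u x))\<^sup>2 \<le> 2 * (norm (\<phi> n x - u x))\<^sup>2 + 2 * (norm (\<phi> n x))\<^sup>2" for x
        using norm_add_sq_le[of "u x - \<phi> n x" "\<phi> n x"] by (simp add: power2_commute)
    qed
    then show ?thesis using I by (simp add: Bochner_Integration.integral_add)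
  qed
  ultimately have "(LINT x|M. (norm (u x))\<^sup>2) \<le> 0"
    by (intro LIMSEQ_le_const) auto
  moreover have "0 \<le> (LINT x|M. (norm (u x))\<^sup>2)" by (auto intro!: integral_nonneg_AE)
  ultimately have "(LINT x|M. (norm (u x))\<^sup>2) = 0" by linarith
  then have "AE x in M. (norm (u x))\<^sup>2 = 0"
    by (subst (asm) integral_nonneg_eq_0_iff_AE[OF square_integrableD[OF u]]) auto
  then show ?thesis by eventually_elim simp
qed

end

section \<open>The chain rule and the linear problem\<close>

lemma norm_add3_sq_le: "(norm (a + b + c :: 'a::real_inner))\<^sup>2 \<le> 4 * (norm a)\<^sup>2 + 4 * (norm b)\<^sup>2 + 2 * (norm c)\<^sup>2"
  using norm_add_sq_le[of "a + b" c] norm_add_sq_le[of a b] by linarith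

lemma DERIV_polynomial_antiderivative:
  "((\<lambda>t. \<Sum>i\<le>k. a i / real (Suc i) * t ^ Suc i) has_real_derivative (\<Sum>i\<le>k. a i * t ^ i)) (at t)"
proof (rule DERIV_sum)
  fix i
  show "((\<lambda>t. a i / real (Suc i) * t ^ Suc i) has_real_derivative a i * t ^ i) (at t)"
    using DERIV_cmult[OF DERIV_pow[of "Suc i" t], of "a i / real (Suc i)"]
    by (simp del: of_nat_Suc power_Suc)
qed

text \<open>Serves for the Kirchhoff transform and for its inverse. The bound on \<gamma> makes
  \<open>G\<close> Lipschitz, which keeps \<open>G\<close> of \<open>u\<close> square integrable and
  transfers convergence of the values; continuity of \<gamma> alone has to carry the convergence of
  the gradients.\<close>

lemma (in bounded_open) H0_pair_compose:
  assumes ug: "H0_pair \<Omega> u g" and G: "\<And>t. (G has_real_derivative \<gamma> t) (at t)" and G0: "G 0 = 0"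
    and \<gamma>: "continuous_on UNIV \<gamma>" and C: "\<And>t. \<bar>\<gamma> t\<bar> \<le> C"
  shows "H0_pair \<Omega> (\<lambda>x. G (u x)) (\<lambda>x. \<gamma> (u x) *\<^sub>R g x)"
proof -
  obtain \<phi>' where u: "square_integrable M u" and g: "square_integrable M g" and \<phi>': "\<And>n. test_fun \<Omega> (\<phi>' n)"
    and lim': "(\<lambda>n. LINT x|M. (norm (\<phi>' n x - u x))\<^sup>2) \<longlonglongrightarrow> 0"
      "(\<lambda>n. LINT x|M. (norm (gradient (\<phi>' n) x - g x))\<^sup>2) \<longlonglongrightarrow> 0"
    using ug unfolding H0_pair_def by blast
  \<comment> \<open>Convergence of \<gamma> along the approximants is obtained by dominated
    convergence, which needs pointwise limits; L2 convergence gives them along a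
    subsequence.\<close>
  obtain r :: "nat \<Rightarrow> nat" where r: "strict_mono r" "AE x in M. (\<lambda>n. \<phi>' (r n) x) \<longlonglongrightarrow> u x"
    by (rule square_integrable_tendsto_subseq_AE[OF square_integrable_test_fun[OF \<phi>'] u lim'(1)])
  define \<phi> where "\<phi> n = \<phi>' (r n)" for n
  have \<phi>: "test_fun \<Omega> (\<phi> n)" for n unfolding \<phi>_def by (rule \<phi>')
  have AE: "AE x in M. (\<lambda>n. \<phi> n x) \<longlonglongrightarrow> u x" unfolding \<phi>_def by (rule r(2))
  have lim: "(\<lambda>n. LINT x|M. (norm (\<phi> n x - u x))\<^sup>2) \<longlonglongrightarrow> 0"
      "(\<lambda>n. LINT x|M. (norm (gradient (\<phi> n) x - g x))\<^sup>2) \<longlonglongrightarrow> 0"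
    using LIMSEQ_subseq_LIMSEQ[OF lim'(1) r(1)] LIMSEQ_subseq_LIMSEQ[OF lim'(2) r(1)]
    unfolding \<phi>_def o_def by auto
  define e where "e n = 1 / real (Suc n)" for n
  have e: "0 < e n" "e n \<le> 1" for n by (auto simp: e_def)
  have e0: "e \<longlonglongrightarrow> 0" unfolding e_def by (rule LIMSEQ_Suc[OF lim_1_over_n])
  have C0: "0 \<le> C" using C[of 0] by linarith
  have G_lip: "\<bar>G s - G t\<bar> \<le> C * \<bar>s - t\<bar>" for s t
    using field_differentiable_bound[of UNIV G \<gamma> C s t] G C by auto
  \<comment> \<open>The error in the values is relative to the size of \<open>\<phi> n x\<close>: an
    absolute bound would involve the radius \<open>m\<close> of the range of
    \<open>\<phi> n\<close>, which is not controlled as \<open>n\<close> grows.\<close>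
  define P where "P n \<psi> p \<longleftrightarrow> test_fun \<Omega> \<psi> \<and> (\<forall>x. \<bar>\<gamma> (\<phi> n x) - p (\<phi> n x)\<bar> \<le> e n)
      \<and> (\<forall>x. \<bar>\<psi> x - G (\<phi> n x)\<bar> \<le> e n * \<bar>\<phi> n x\<bar>)
      \<and> (\<forall>x. gradient \<psi> x = p (\<phi> n x) *\<^sub>R gradient (\<phi> n) x)" for n \<psi> and p :: "real \<Rightarrow> real"
  have "\<exists>\<psi> p. P n \<psi> p" for n
  proof -
    obtain m where m: "m \<ge> 0" "\<And>x. \<bar>\<phi> n x\<bar> \<le> m" using test_fun_bounded[OF \<phi>] by metis
    obtain p where p: "real_polynomial_function p" "\<And>t. t \<in> cball 0 m \<Longrightarrow> \<bar>\<gamma> t - p t\<bar> < e n"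
      using Stone_Weierstrass_real_polynomial_function[of "cball 0 m" \<gamma> "e n"] e continuous_on_subset[OF \<gamma>]
      by (metis compact_cball subset_UNIV)
    obtain a k where ak: "p = (\<lambda>t. \<Sum>i\<le>k. a i * t ^ i)"
      using p(1) unfolding real_polynomial_function_iff_sum by blast
    \<comment> \<open>The antiderivative of \<open>p\<close> that vanishes at 0, as \<open>G\<close>
      does; the mean value inequality turns the uniform bound on the derivatives into the relative
      bound on the values.\<close>
    define Q where "Q t = (\<Sum>i\<le>k. a i / real (Suc i) * t ^ Suc i)" for t
    have Q: "(Q has_real_derivative p t) (at t)" for t
      unfolding Q_def[abs_def] ak by (rule DERIV_polynomial_antiderivative)
    have "\<bar>Q t - G t\<bar> \<le> e n * \<bar>t\<bar>" if t: "t \<in> cball 0 m" for t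
    proof -
      have "norm ((Q t - G t) - (Q 0 - G 0)) \<le> e n * norm (t - 0)"
      proof (rule field_differentiable_bound[of "cball 0 m" "\<lambda>t. Q t - G t" "\<lambda>t. p t - \<gamma> t"])
        show "((\<lambda>t. Q t - G t) has_real_derivative p z - \<gamma> z) (at z within cball 0 m)" for z
          by (rule has_field_derivative_at_within[OF DERIV_diff[OF Q G]])
        show "norm (p z - \<gamma> z) \<le> e n" if "z \<in> cball 0 m" for z
          using p(2)[OF that] by simp
      qed (use m t in auto)
      then show ?thesis using G0 by (simp add: Q_def)
    qed
    moreover have "\<phi> n x \<in> cball 0 m" for x using m(2)[of x] by simp
    ultimately have "\<forall>x. \<bar>\<gamma> (\<phi> n x) - p (\<phi> n x)\<bar> \<le> e n \<and> \<bar>Q (\<phi> n x) - G (\<phi> n x)\<bar> \<le> e n * \<bar>\<phi> n x\<bar>"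
      using p(2) less_imp_le by blast
    moreover have "test_fun \<Omega> (\<lambda>x. Q (\<phi> n x))"
      unfolding Q_def by (rule test_fun_poly[OF \<phi>])
    moreover have "gradient (\<lambda>x. Q (\<phi> n x)) x = p (\<phi> n x) *\<^sub>R gradient (\<phi> n) x" for x
      by (rule gradient_compose[OF test_fun_differentiable[OF \<phi>] Q])
    ultimately show ?thesis
      unfolding P_def by (intro exI[of _ "\<lambda>x. Q (\<phi> n x)"] exI[of _ p]) blast
  qed
  then obtain \<psi> p where P: "\<And>n. P n (\<psi> n) (p n)" by metis
  have \<psi>: "test_fun \<Omega> (\<psi> n)" and ak: "\<bar>\<gamma> (\<phi> n x) - p n (\<phi> n x)\<bar> \<le> e n" "\<bar>\<psi> n x - G (\<phi> n x)\<bar> \<le> e n * \<bar>\<phi> n x\<bar>"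
    and grad: "gradient (\<psi> n) x = p n (\<phi> n x) *\<^sub>R gradient (\<phi> n) x" for n x
    using P[of n] unfolding P_def by blast+
  have [measurable]: "\<gamma> \<in> borel_measurable borel" "G \<in> borel_measurable borel"
    using \<gamma> DERIV_isCont[OF G] by (auto intro!: borel_measurable_continuous_onI continuous_at_imp_continuous_on)
  have um [measurable]: "u \<in> borel_measurable M" using u by (rule square_integrable_measurable)
  have gm [measurable]: "g \<in> borel_measurable M" using g by (rule square_integrable_measurable)
  have \<phi>m [measurable]: "\<phi> n \<in> borel_measurable M" for n
    using square_integrable_test_fun[OF \<phi>] by (rule square_integrable_measurable)
  have Gu: "square_integrable M (\<lambda>x. G (u x))"
    using G_lip[of _ 0] G0 by (intro square_integrable_bound[OF u, where C=C]) auto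
  have \<gamma>ug: "square_integrable M (\<lambda>x. \<gamma> (u x) *\<^sub>R g x)"
    using C by (intro square_integrable_mult_bounded[OF g, where C=C]) auto
  have intu: "integrable M (\<lambda>x. (norm (u x))\<^sup>2)" "integrable M (\<lambda>x. (norm (g x))\<^sup>2)"
    and intd: "integrable M (\<lambda>x. (norm (\<phi> n x - u x))\<^sup>2)" "integrable M (\<lambda>x. (norm (gradient (\<phi> n) x - g x))\<^sup>2)" for n
    by (intro square_integrableD square_integrable_diff square_integrable_test_fun square_integrable_gradient u g \<phi>)+
  have e2: "(\<lambda>n. 2 * (e n)\<^sup>2 * L) \<longlonglongrightarrow> 0" "(\<lambda>n. 4 * (e n)\<^sup>2 * L) \<longlonglongrightarrow> 0" for L
    using tendsto_mult_left[OF tendsto_power[OF e0, of 2], of "2 * L"]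
      tendsto_mult_left[OF tendsto_power[OF e0, of 2], of "4 * L"] by (simp_all add: mult_ac)
  have lim_mult: "(\<lambda>n. c * X n) \<longlonglongrightarrow> 0" if "X \<longlonglongrightarrow> 0" for c and X :: "nat \<Rightarrow> real"
    using tendsto_mult_right_zero[OF that] by simp
  have 1: "(\<lambda>n. LINT x|M. (norm (\<psi> n x - G (u x)))\<^sup>2) \<longlonglongrightarrow> 0"
  proof (rule integral_tendsto_0_squeeze)
    \<comment> \<open>\<open>C\<close> comes from the Lipschitz bound of \<open>G\<close>; the
      additional 1 comes from replacing \<open>\<phi> n\<close> by \<open>u\<close> in the relative
      error, where \<open>e n \<le> 1\<close>.\<close>
    let ?b = "\<lambda>n x. 2 * (C + 1)\<^sup>2 * (norm (\<phi> n x - u x))\<^sup>2 + 2 * (e n)\<^sup>2 * (norm (u x))\<^sup>2"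
    show "integrable M (?b n)" for n
      by (intro Bochner_Integration.integrable_add integrable_mult_right intu intd)
    have "(LINT x|M. ?b n x) = 2 * (C + 1)\<^sup>2 * (LINT x|M. (norm (\<phi> n x - u x))\<^sup>2) + 2 * (e n)\<^sup>2 * (LINT x|M. (norm (u x))\<^sup>2)" for n
      by (subst Bochner_Integration.integral_add) (auto intro!: integrable_mult_right intu intd simp del: real_norm_def)
    moreover have "(\<lambda>n. 2 * (C + 1)\<^sup>2 * (LINT x|M. (norm (\<phi> n x - u x))\<^sup>2) + 2 * (e n)\<^sup>2 * (LINT x|M. (norm (u x))\<^sup>2)) \<longlonglongrightarrow> 0"
      using tendsto_add[OF lim_mult[OF lim(1)] e2(1)] by simp
    ultimately show "(\<lambda>n. LINT x|M. ?b n x) \<longlonglongrightarrow> 0" by simp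
    fix n x
    have "norm (\<psi> n x - G (u x)) \<le> \<bar>\<psi> n x - G (\<phi> n x)\<bar> + \<bar>G (\<phi> n x) - G (u x)\<bar>" by simp
    also have "\<dots> \<le> e n * \<bar>\<phi> n x\<bar> + C * \<bar>\<phi> n x - u x\<bar>"
      using ak(2)[where n=n and x=x] G_lip[of "\<phi> n x" "u x"] by linarith
    also have "\<dots> \<le> (C + 1) * norm (\<phi> n x - u x) + e n * norm (u x)"
    proof -
      have "e n * \<bar>\<phi> n x\<bar> \<le> e n * (\<bar>\<phi> n x - u x\<bar> + \<bar>u x\<bar>)" using e[of n] by (intro mult_left_mono) auto
      moreover have "e n * \<bar>\<phi> n x - u x\<bar> \<le> \<bar>\<phi> n x - u x\<bar>" using e[of n] by (intro mult_left_le_one_le) auto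
      ultimately show ?thesis by (simp add: algebra_simps)
    qed
    finally have "(norm (\<psi> n x - G (u x)))\<^sup>2 \<le> (norm ((C + 1) * norm (\<phi> n x - u x) + e n * norm (u x)))\<^sup>2"
      by (intro power_mono) auto
    also have "\<dots> \<le> ?b n x"
      using norm_add_sq_le[of "(C + 1) * norm (\<phi> n x - u x)" "e n * norm (u x)"]
      by (simp add: power_mult_distrib)
    finally show "(norm (\<psi> n x - G (u x)))\<^sup>2 \<le> ?b n x" .
  qed simp
  have dct: "(\<lambda>n. LINT x|M. (norm ((\<gamma> (\<phi> n x) - \<gamma> (u x)) *\<^sub>R g x))\<^sup>2) \<longlonglongrightarrow> (LINT x|M. 0)"
  proof (rule integral_dominated_convergence)
    show "integrable M (\<lambda>x. (2 * C)\<^sup>2 * (norm (g x))\<^sup>2)" by (intro integrable_mult_right intu)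
    show "AE x in M. (\<lambda>n. (norm ((\<gamma> (\<phi> n x) - \<gamma> (u x)) *\<^sub>R g x))\<^sup>2) \<longlonglongrightarrow> 0"
      using AE
    proof eventually_elim
      case (elim x)
      have "(\<lambda>n. \<gamma> (\<phi> n x)) \<longlonglongrightarrow> \<gamma> (u x)"
        using \<gamma> elim by (intro isCont_tendsto_compose[where g=\<gamma>]) (auto simp: continuous_on_eq_continuous_at)
      then have "(\<lambda>n. (norm ((\<gamma> (\<phi> n x) - \<gamma> (u x)) *\<^sub>R g x))\<^sup>2) \<longlonglongrightarrow> (norm ((\<gamma> (u x) - \<gamma> (u x)) *\<^sub>R g x))\<^sup>2"
        by (intro tendsto_intros)
      then show ?case by simp
    qed
    show "AE x in M. norm ((norm ((\<gamma> (\<phi> n x) - \<gamma> (u x)) *\<^sub>R g x))\<^sup>2) \<le> (2 * C)\<^sup>2 * (norm (g x))\<^sup>2" for n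
    proof (rule AE_I2)
      fix x
      have "\<bar>\<gamma> (\<phi> n x) - \<gamma> (u x)\<bar> \<le> 2 * C" using C[of "\<phi> n x"] C[of "u x"] by linarith
      then have "(norm ((\<gamma> (\<phi> n x) - \<gamma> (u x)) *\<^sub>R g x))\<^sup>2 \<le> (2 * C * norm (g x))\<^sup>2"
        by (intro power_mono) (auto intro!: mult_right_mono)
      then show "norm ((norm ((\<gamma> (\<phi> n x) - \<gamma> (u x)) *\<^sub>R g x))\<^sup>2) \<le> (2 * C)\<^sup>2 * (norm (g x))\<^sup>2"
        by (simp add: power_mult_distrib)
    qed
  qed measurable
  have 2: "(\<lambda>n. LINT x|M. (norm (gradient (\<psi> n) x - \<gamma> (u x) *\<^sub>R g x))\<^sup>2) \<longlonglongrightarrow> 0"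
  proof (rule integral_tendsto_0_squeeze)
    let ?c = "\<lambda>n x. (norm ((\<gamma> (\<phi> n x) - \<gamma> (u x)) *\<^sub>R g x))\<^sup>2"
    let ?b = "\<lambda>n x. 4 * (C + 1)\<^sup>2 * (norm (gradient (\<phi> n) x - g x))\<^sup>2 + 4 * (e n)\<^sup>2 * (norm (g x))\<^sup>2 + 2 * ?c n x"
    have "square_integrable M (\<lambda>x. (\<gamma> (\<phi> n x) - \<gamma> (u x)) *\<^sub>R g x)" for n
    proof (rule square_integrable_mult_bounded[OF g, where C="2 * C"])
      show "AE x in M. \<bar>\<gamma> (\<phi> n x) - \<gamma> (u x)\<bar> \<le> 2 * C"
      proof (rule AE_I2)
        show "\<bar>\<gamma> (\<phi> n x) - \<gamma> (u x)\<bar> \<le> 2 * C" for x using C[of "\<phi> n x"] C[of "u x"] by linarith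
      qed
    qed measurable
    then have intc: "integrable M (?c n)" for n by (rule square_integrableD)
    show "integrable M (?b n)" for n
      by (intro Bochner_Integration.integrable_add integrable_mult_right intu intd intc)
    have "(LINT x|M. ?b n x) = 4 * (C + 1)\<^sup>2 * (LINT x|M. (norm (gradient (\<phi> n) x - g x))\<^sup>2)
        + 4 * (e n)\<^sup>2 * (LINT x|M. (norm (g x))\<^sup>2) + 2 * (LINT x|M. ?c n x)" for n
      using intu(2) intd(2)[of n] intc[of n]
      by (simp add: Bochner_Integration.integral_add del: norm_scaleR)
    moreover have "(\<lambda>n. 4 * (C + 1)\<^sup>2 * (LINT x|M. (norm (gradient (\<phi> n) x - g x))\<^sup>2)
        + 4 * (e n)\<^sup>2 * (LINT x|M. (norm (g x))\<^sup>2) + 2 * (LINT x|M. ?c n x)) \<longlonglongrightarrow> 0 + 0 + 0"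
      by (intro tendsto_add lim_mult lim e2) (use dct in simp)
    ultimately show "(\<lambda>n. LINT x|M. ?b n x) \<longlonglongrightarrow> 0" by simp
    fix n x
    let ?p = "p n (\<phi> n x)"
    have p: "\<bar>?p\<bar> \<le> C + 1" using ak(1)[where n=n and x=x] C[of "\<phi> n x"] e[of n] by linarith
    \<comment> \<open>Both coefficient errors multiply the limit \<open>g\<close> and not the
      gradient of \<open>\<phi> n\<close>. For the last term this provides the fixed integrable
      majorant used in \<open>dct\<close>; the other two terms vanish by convergence of the
      gradients and by smallness of \<open>e n\<close>.\<close>
    have "gradient (\<psi> n) x - \<gamma> (u x) *\<^sub>R g x
        = ?p *\<^sub>R (gradient (\<phi> n) x - g x) + (?p - \<gamma> (\<phi> n x)) *\<^sub>R g x + (\<gamma> (\<phi> n x) - \<gamma> (u x)) *\<^sub>R g x"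
      unfolding grad by (simp add: algebra_simps)
    then have "(norm (gradient (\<psi> n) x - \<gamma> (u x) *\<^sub>R g x))\<^sup>2 \<le> 4 * (norm (?p *\<^sub>R (gradient (\<phi> n) x - g x)))\<^sup>2
        + 4 * (norm ((?p - \<gamma> (\<phi> n x)) *\<^sub>R g x))\<^sup>2 + 2 * ?c n x"
      using norm_add3_sq_le by metis
    moreover have "(norm (?p *\<^sub>R (gradient (\<phi> n) x - g x)))\<^sup>2 \<le> (C + 1)\<^sup>2 * (norm (gradient (\<phi> n) x - g x))\<^sup>2"
      unfolding norm_scaleR power_mult_distrib using p C0 by (intro mult_right_mono power_mono) auto
    moreover have "(norm ((?p - \<gamma> (\<phi> n x)) *\<^sub>R g x))\<^sup>2 \<le> (e n)\<^sup>2 * (norm (g x))\<^sup>2"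
      unfolding norm_scaleR power_mult_distrib using ak(1)[where n=n and x=x] e[of n]
      by (intro mult_right_mono power_mono) (auto simp: abs_minus_commute)
    ultimately show "(norm (gradient (\<psi> n) x - \<gamma> (u x) *\<^sub>R g x))\<^sup>2 \<le> ?b n x"
      by linarith
  qed simp
  show ?thesis
    unfolding H0_pair_def using Gu \<gamma>ug \<psi> 1 2 by blast
qed

section \<open>The linear problem with coefficient \<alpha>\<close>

locale elliptic = bounded_open +
  fixes \<alpha> f :: "'a \<Rightarrow> real" and \<alpha>0 \<alpha>1 :: real
  assumes \<alpha>_measurable: "\<alpha> \<in> borel_measurable M" and \<alpha>0_pos: "0 < \<alpha>0"
    and \<alpha>_bounds: "AE x in M. \<alpha>0 \<le> \<alpha> x \<and> \<alpha> x \<le> \<alpha>1"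
    and square_integrable_f: "square_integrable M f"
begin

text \<open>The arguments are arbitrary fields rather than functions, so that the form can be
  applied to \<open>b(u)\<close> times a gradient and to limits of gradients without reference to a
  potential.\<close>

definition energy :: "('a \<Rightarrow> 'a) \<Rightarrow> ('a \<Rightarrow> 'a) \<Rightarrow> real" where
  "energy g h = (LINT x|M. (\<alpha> x *\<^sub>R g x) \<bullet> h x)"

lemma square_integrable_\<alpha>: "square_integrable M g \<Longrightarrow> square_integrable M (\<lambda>x. \<alpha> x *\<^sub>R g x)"
proof (rule square_integrable_mult_bounded[OF _ \<alpha>_measurable, where C=\<alpha>1])
  show "AE x in M. \<bar>\<alpha> x\<bar> \<le> \<alpha>1" using \<alpha>_bounds by eventually_elim (use \<alpha>0_pos in auto)
qed

lemma energy_integrable: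
  "square_integrable M g \<Longrightarrow> square_integrable M h \<Longrightarrow> integrable M (\<lambda>x. (\<alpha> x *\<^sub>R g x) \<bullet> h x)"
  by (intro integrable_inner_square_integrable square_integrable_\<alpha>)

lemma energy_add_scaleR:
  assumes g: "square_integrable M g" and h: "square_integrable M h"
  shows "energy (\<lambda>x. g x + t *\<^sub>R h x) (\<lambda>x. g x + t *\<^sub>R h x) = energy g g + 2 * t * energy g h + t\<^sup>2 * energy h h"
proof -
  have "energy (\<lambda>x. g x + t *\<^sub>R h x) (\<lambda>x. g x + t *\<^sub>R h x)
      = (LINT x|M. (\<alpha> x *\<^sub>R g x) \<bullet> g x + 2 * t * ((\<alpha> x *\<^sub>R g x) \<bullet> h x) + t\<^sup>2 * ((\<alpha> x *\<^sub>R h x) \<bullet> h x))"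
    unfolding energy_def
    by (intro Bochner_Integration.integral_cong) (auto simp: algebra_simps inner_commute power2_eq_square)
  then show ?thesis
    unfolding energy_def using energy_integrable[OF g g] energy_integrable[OF g h] energy_integrable[OF h h]
    by (simp del: inner_scaleR_left)
qed

lemma energy_coercive:
  assumes g: "square_integrable M g"
  shows "\<alpha>0 * (LINT x|M. (norm (g x))\<^sup>2) \<le> energy g g"
proof -
  have "(LINT x|M. \<alpha>0 * (norm (g x))\<^sup>2) \<le> energy g g"
    unfolding energy_def
  proof (rule integral_mono_AE)
    show "AE x in M. \<alpha>0 * (norm (g x))\<^sup>2 \<le> (\<alpha> x *\<^sub>R g x) \<bullet> g x"
      using \<alpha>_bounds by eventually_elim (auto simp: power2_norm_eq_inner intro!: mult_right_mono)
  qed (intro integrable_mult_right square_integrableD energy_integrable g)+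
  then show ?thesis by simp
qed

lemma energy_nonneg: "square_integrable M g \<Longrightarrow> 0 \<le> energy g g"
  by (rule order_trans[OF _ energy_coercive]) (auto intro!: mult_nonneg_nonneg integral_nonneg_AE less_imp_le[OF \<alpha>0_pos])

lemma energy_cong_AE:
  assumes "square_integrable M g" "square_integrable M h" "square_integrable M g'" "square_integrable M h'"
    and "AE x in M. g x = g' x" "AE x in M. h x = h' x"
  shows "energy g h = energy g' h'"
  unfolding energy_def
proof (rule integral_cong_AE)
  show "AE x in M. \<alpha> x *\<^sub>R g x \<bullet> h x = \<alpha> x *\<^sub>R g' x \<bullet> h' x"
    using assms(5,6) by eventually_elim simp
qed (intro borel_measurable_integrable energy_integrable assms)+

text \<open>The weak form of the linear equation. It quantifies over pairs, so the representatives
  chosen by \<open>weak_grad\<close> do not enter.\<close>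

definition solves :: "('a \<Rightarrow> 'a) \<Rightarrow> bool" where
  "solves g \<longleftrightarrow> (\<forall>v h. H0_pair \<Omega> v h \<longrightarrow> energy g h = (LINT x|M. f x * v x))"

text \<open>The difference of the two solutions is tested with itself: coercivity kills its
  gradient, and zero boundary values then kill the function.\<close>

lemma solves_unique:
  assumes w: "H0_pair \<Omega> w g" "solves g" and w': "H0_pair \<Omega> w' g'" "solves g'"
  shows "AE x in M. w x = w' x"
proof -
  note d = H0_pair_diff[OF w(1) w'(1)]
  have g: "square_integrable M g" "square_integrable M g'" using w(1) w'(1) by (auto simp: H0_pair_def)
  then have dg: "square_integrable M (\<lambda>x. g x - g' x)" by (rule square_integrable_diff)
  have "energy (\<lambda>x. g x - g' x) (\<lambda>x. g x - g' x) = energy g (\<lambda>x. g x - g' x) - energy g' (\<lambda>x. g x - g' x)"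
    unfolding energy_def scaleR_diff_right inner_diff_left[of "\<alpha> _ *\<^sub>R _"]
    by (intro Bochner_Integration.integral_diff energy_integrable g dg)
  also have "\<dots> = 0" using w(2) w'(2) d unfolding solves_def by simp
  finally have "\<alpha>0 * (LINT x|M. (norm (g x - g' x))\<^sup>2) \<le> 0"
    using energy_coercive[OF dg] by simp
  then have "(LINT x|M. (norm (g x - g' x))\<^sup>2) \<le> 0"
    using \<alpha>0_pos by (simp add: mult_le_0_iff)
  moreover have "0 \<le> (LINT x|M. (norm (g x - g' x))\<^sup>2)" by (auto intro!: integral_nonneg_AE)
  ultimately have "(LINT x|M. (norm (g x - g' x))\<^sup>2) = 0" by linarith
  then have "AE x in M. (norm (g x - g' x))\<^sup>2 = 0"
    by (subst (asm) integral_nonneg_eq_0_iff_AE[OF square_integrableD[OF dg]]) auto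
  then have "AE x in M. g x - g' x = 0" by eventually_elim simp
  then have "AE x in M. w x - w' x = 0" by (rule H0_pair_gradient_0[OF d])
  then show ?thesis by eventually_elim simp
qed

text \<open>The direct method: by the parallelogram identity a minimising sequence of test functions
  for \<open>J\<close> is Cauchy in energy.\<close>

theorem solves_exists: "\<exists>w g. H0_pair \<Omega> w g \<and> solves g"
proof -
  note sq = square_integrable_test_fun square_integrable_gradient square_integrable_f
  define F where "F \<phi> = (LINT x|M. f x * \<phi> x)" for \<phi>
  define J where "J \<phi> = energy (gradient \<phi>) (gradient \<phi>) - 2 * F \<phi>" for \<phi>
  \<comment> \<open>This exact expansion is used twice: with the difference of two minimising terms
    to show that the sequence is Cauchy, and with an arbitrary direction to derive the equation for
    the limit.\<close>
  have J_add: "J (\<lambda>x. \<phi> x + t * \<psi> x) = J \<phi> + 2 * t * (energy (gradient \<phi>) (gradient \<psi>) - F \<psi>)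
      + t\<^sup>2 * energy (gradient \<psi>) (gradient \<psi>)" if "test_fun \<Omega> \<phi>" "test_fun \<Omega> \<psi>" for \<phi> \<psi> t
  proof -
    have "gradient (\<lambda>x. \<phi> x + t * \<psi> x) x = gradient \<phi> x + t *\<^sub>R gradient \<psi> x" for x
      using gradient_add[OF test_fun_differentiable[OF that(1)] test_fun_differentiable[OF test_fun_cmult[OF that(2)]]]
        gradient_cmult[OF test_fun_differentiable[OF that(2)]] by simp
    then have "gradient (\<lambda>x. \<phi> x + t * \<psi> x) = (\<lambda>x. gradient \<phi> x + t *\<^sub>R gradient \<psi> x)" by (rule ext)
    moreover have "F (\<lambda>x. \<phi> x + t * \<psi> x) = F \<phi> + t * F \<psi>"
    proof -
      have "F (\<lambda>x. \<phi> x + t * \<psi> x) = (LINT x|M. f x * \<phi> x + t * (f x * \<psi> x))"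
        unfolding F_def by (simp add: algebra_simps)
      then show ?thesis
        unfolding F_def using integrable_mult_square_integrable[OF square_integrable_f sq(1)] that by simp
    qed
    ultimately show ?thesis
      unfolding J_def using energy_add_scaleR[OF sq(2)[OF that(1)] sq(2)[OF that(2)], of t]
      by (simp add: algebra_simps)
  qed
  obtain R where R: "\<And>x. x \<in> \<Omega> \<Longrightarrow> norm x \<le> R"
    using bounded_domain unfolding bounded_iff by blast
  \<comment> \<open>The summand 1 makes the Poincare constant positive, so that it can be divided
    by.\<close>
  define c where "c = 4 * R\<^sup>2 + 1"
  have c: "c > 0" unfolding c_def by (intro add_nonneg_pos) auto
  have poincare: "(LINT x|M. (norm (\<phi> x))\<^sup>2) \<le> c * (LINT x|M. (norm (gradient \<phi> x))\<^sup>2)" if "test_fun \<Omega> \<phi>" for \<phi>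
  proof -
    have "0 \<le> (LINT x|M. (norm (gradient \<phi> x))\<^sup>2)" by (auto intro!: integral_nonneg_AE)
    moreover have "(LINT x|M. (norm (\<phi> x))\<^sup>2) \<le> 4 * R\<^sup>2 * (LINT x|M. (norm (gradient \<phi> x))\<^sup>2)"
      by (rule Poincare_test_fun[OF that R])
    ultimately show ?thesis unfolding c_def distrib_right mult_1 by linarith
  qed
  define K where "K = (c / \<alpha>0) * (LINT x|M. (norm (f x))\<^sup>2)"
  have J_bounded: "- K \<le> J \<phi>" if \<phi>: "test_fun \<Omega> \<phi>" for \<phi>
  proof -
    \<comment> \<open>The weight in Young's inequality for 2 f \<phi>. It is chosen so that after
      the Poincare inequality the \<phi> term costs exactly \<alpha>0 times the squared norm of the
      gradient, which coercivity pays for.\<close>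
    define d where "d = \<alpha>0 / c"
    have d: "d > 0" "d * c = \<alpha>0" "inverse d = c / \<alpha>0" using c \<alpha>0_pos by (auto simp: d_def)
    have "2 * F \<phi> = (LINT x|M. 2 * (f x * \<phi> x))" unfolding F_def by simp
    also have "\<dots> \<le> (LINT x|M. inverse d * (norm (f x))\<^sup>2 + d * (norm (\<phi> x))\<^sup>2)"
    proof (rule integral_mono)
      show "integrable M (\<lambda>x. 2 * (f x * \<phi> x))"
        by (intro integrable_mult_right integrable_mult_square_integrable sq \<phi>)
      show "integrable M (\<lambda>x. inverse d * (norm (f x))\<^sup>2 + d * (norm (\<phi> x))\<^sup>2)"
        by (intro Bochner_Integration.integrable_add integrable_mult_right square_integrableD sq \<phi>)
      show "2 * (f x * \<phi> x) \<le> inverse d * (norm (f x))\<^sup>2 + d * (norm (\<phi> x))\<^sup>2" for x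
      proof -
        have "0 \<le> inverse d * (f x - d * \<phi> x)\<^sup>2"
          using d(1) by (intro mult_nonneg_nonneg) auto
        also have "\<dots> = inverse d * (f x)\<^sup>2 + d * (\<phi> x)\<^sup>2 - 2 * (f x * \<phi> x)"
          using d(1) by (simp add: power2_eq_square field_simps)
        finally show ?thesis by simp
      qed
    qed
    also have "\<dots> = K + d * (LINT x|M. (norm (\<phi> x))\<^sup>2)"
      unfolding K_def d(3)[symmetric]
      using square_integrableD[OF sq(1)[OF \<phi>]] square_integrableD[OF square_integrable_f] by simp
    also have "d * (LINT x|M. (norm (\<phi> x))\<^sup>2) \<le> d * (c * (LINT x|M. (norm (gradient \<phi> x))\<^sup>2))"
      using poincare[OF \<phi>] d by (intro mult_left_mono) auto
    also have "\<dots> = \<alpha>0 * (LINT x|M. (norm (gradient \<phi> x))\<^sup>2)" using d by (simp add: mult.assoc[symmetric])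
    also have "\<dots> \<le> energy (gradient \<phi>) (gradient \<phi>)" by (rule energy_coercive[OF sq(2)[OF \<phi>]])
    finally show ?thesis unfolding J_def by simp
  qed
  define I where "I = Inf (J ` Collect (test_fun \<Omega>))"
  have bdd: "bdd_below (J ` Collect (test_fun \<Omega>))"
    using J_bounded by (intro bdd_belowI[of _ "- K"]) auto
  have I: "I \<le> J \<phi>" if "test_fun \<Omega> \<phi>" for \<phi>
    unfolding I_def using that by (intro cInf_lower bdd) auto
  have "\<exists>\<phi>. test_fun \<Omega> \<phi> \<and> J \<phi> < I + 1 / real (Suc n)" for n
  proof -
    have "J ` Collect (test_fun \<Omega>) \<noteq> {}" using test_fun_zero by blast
    from cInf_lessD[OF this, of "I + 1 / real (Suc n)"] show ?thesis unfolding I_def[symmetric] by auto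
  qed
  then obtain \<phi> where \<phi>: "\<And>n. test_fun \<Omega> (\<phi> n)" and J\<phi>: "\<And>n. J (\<phi> n) < I + 1 / real (Suc n)" by metis
  have Cauchy: "\<alpha>0 * (LINT x|M. (norm (gradient (\<phi> m) x - gradient (\<phi> n) x))\<^sup>2) \<le> 2 / real (Suc m) + 2 / real (Suc n)" for m n
  proof -
    define \<delta> where "\<delta> x = \<phi> m x - \<phi> n x" for x
    have \<delta>: "test_fun \<Omega> \<delta>" unfolding \<delta>_def[abs_def] by (intro test_fun_diff \<phi>)
    have grad: "gradient \<delta> x = gradient (\<phi> m) x - gradient (\<phi> n) x" for x
      unfolding \<delta>_def[abs_def] by (intro gradient_diff test_fun_differentiable[OF \<phi>])
    have m: "(\<lambda>x. \<phi> n x + 1 * \<delta> x) = \<phi> m" by (simp add: \<delta>_def)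
    \<comment> \<open>This is the midpoint of \<open>\<phi> m\<close> and \<open>\<phi> n\<close>.
      In J(m) + J(n) - 2 J(midpoint) the linear terms cancel and half the energy of \<delta>
      remains; as J is at least I at the midpoint, the energy is below twice the two excesses over
      I.\<close>
    have "I \<le> J (\<lambda>x. \<phi> n x + (1/2) * \<delta> x)"
      by (intro I test_fun_add test_fun_cmult \<phi> \<delta>)
    with J_add[OF \<phi>[of n] \<delta>, of "1/2"] J_add[OF \<phi>[of n] \<delta>, of 1] J\<phi>[of m] J\<phi>[of n]
    have "energy (gradient \<delta>) (gradient \<delta>) \<le> 2 / real (Suc m) + 2 / real (Suc n)"
      unfolding m by (simp add: power2_eq_square)
    then show ?thesis using energy_coercive[OF sq(2)[OF \<delta>]] unfolding grad by linarith
  qed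
  \<comment> \<open>The factor \<open>k\<close> lets one statement serve the gradients, with
    \<open>k = 1\<close>, and through the Poincare inequality the functions, with
    \<open>k = c\<close>.\<close>
  have small: "\<exists>N. \<forall>m\<ge>N. \<forall>n\<ge>N. k * (LINT x|M. (norm (gradient (\<phi> m) x - gradient (\<phi> n) x))\<^sup>2) \<le> e"
    if "e > 0" "k > 0" for e k
  proof -
    obtain N where N: "N > 0" "4 * k / (\<alpha>0 * e) < real N" using reals_Archimedean2
      by (metis gr0I less_trans of_nat_0_less_iff not_less_iff_gr_or_eq zero_less_divide_iff that \<alpha>0_pos mult_pos_pos zero_less_numeral of_nat_0)
    have "k * (LINT x|M. (norm (gradient (\<phi> m) x - gradient (\<phi> n) x))\<^sup>2) \<le> e" if mn: "m \<ge> N" "n \<ge> N" for m n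
    proof -
      have "2 / real (Suc m) \<le> 2 / real N" "2 / real (Suc n) \<le> 2 / real N"
        using mn N by (auto intro!: divide_left_mono mult_pos_pos)
      then have "\<alpha>0 * (LINT x|M. (norm (gradient (\<phi> m) x - gradient (\<phi> n) x))\<^sup>2) \<le> 4 / real N"
        using Cauchy[of m n] by linarith
      then have "k * (\<alpha>0 * (LINT x|M. (norm (gradient (\<phi> m) x - gradient (\<phi> n) x))\<^sup>2)) \<le> k * (4 / real N)"
        using \<open>k > 0\<close> by (intro mult_left_mono) auto
      also have "\<dots> \<le> \<alpha>0 * e" using N \<open>e > 0\<close> \<alpha>0_pos by (simp add: field_simps)
      finally have "\<alpha>0 * (k * (LINT x|M. (norm (gradient (\<phi> m) x - gradient (\<phi> n) x))\<^sup>2)) \<le> \<alpha>0 * e"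
        by (simp add: mult_ac)
      then show ?thesis using \<alpha>0_pos by simp
    qed
    then show ?thesis by blast
  qed
  obtain g where g: "square_integrable M g" and g_lim: "(\<lambda>n. LINT x|M. (norm (gradient (\<phi> n) x - g x))\<^sup>2) \<longlonglongrightarrow> 0"
    by (rule square_integrable_complete[of M "\<lambda>n. gradient (\<phi> n)"]) (use sq(2)[OF \<phi>] small[where k=1] in auto)
  obtain w where w: "square_integrable M w" and w_lim: "(\<lambda>n. LINT x|M. (norm (\<phi> n x - w x))\<^sup>2) \<longlonglongrightarrow> 0"
  proof (rule square_integrable_complete[of M \<phi>])
    show "square_integrable M (\<phi> n)" for n by (rule sq(1)[OF \<phi>])
    fix e :: real assume "e > 0"
    have "(LINT x|M. (norm (\<phi> m x - \<phi> n x))\<^sup>2) \<le> c * (LINT x|M. (norm (gradient (\<phi> m) x - gradient (\<phi> n) x))\<^sup>2)" for m n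
      using poincare[OF test_fun_diff[OF \<phi>[of m] \<phi>[of n]]]
        gradient_diff[OF test_fun_differentiable[OF \<phi>[of m]] test_fun_differentiable[OF \<phi>[of n]]] by simp
    with small[OF \<open>e > 0\<close> c] show "\<exists>N. \<forall>m\<ge>N. \<forall>n\<ge>N. (LINT x|M. (norm (\<phi> m x - \<phi> n x))\<^sup>2) \<le> e"
      by (meson order_trans)
  qed blast
  have pair: "H0_pair \<Omega> w g"
    unfolding H0_pair_def using w g \<phi> w_lim g_lim by blast
  have test: "energy g (gradient \<psi>) = F \<psi>" if \<psi>: "test_fun \<Omega> \<psi>" for \<psi>
  proof -
    define L where "L = energy g (gradient \<psi>) - F \<psi>"
    define E where "E = energy (gradient \<psi>) (gradient \<psi>)"
    have E: "E \<ge> 0" unfolding E_def by (rule energy_nonneg[OF sq(2)[OF \<psi>]])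
    have lim: "(\<lambda>n. energy (gradient (\<phi> n)) (gradient \<psi>)) \<longlonglongrightarrow> energy g (gradient \<psi>)"
    proof -
      have "(\<lambda>n. LINT x|M. (\<alpha> x *\<^sub>R gradient \<psi> x) \<bullet> gradient (\<phi> n) x) \<longlonglongrightarrow> (LINT x|M. (\<alpha> x *\<^sub>R gradient \<psi> x) \<bullet> g x)"
        by (intro tendsto_integral_inner square_integrable_\<alpha> sq \<psi> \<phi> g g_lim)
      then show ?thesis unfolding energy_def by (simp add: inner_commute)
    qed
    \<comment> \<open>A perturbed minimising term still has J at least I, while
      \<open>J (\<phi> n)\<close> exceeds I by less than \<open>1 / real (Suc n)\<close>. In the
      limit the first variation \<open>L\<close> of the limit field appears, although J is never
      evaluated there.\<close>
    have quadratic: "0 \<le> 2 * t * L + t\<^sup>2 * E" for t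
    proof (rule LIMSEQ_le_const)
      show "(\<lambda>n. 2 * t * (energy (gradient (\<phi> n)) (gradient \<psi>) - F \<psi>) + t\<^sup>2 * E + 1 / real (Suc n))
          \<longlonglongrightarrow> 2 * t * L + t\<^sup>2 * E"
        unfolding L_def
        using tendsto_add[OF tendsto_add[OF tendsto_mult_left[OF tendsto_diff[OF lim tendsto_const[of "F \<psi>"]], of "2 * t"]
            tendsto_const[of "t\<^sup>2 * E"]] LIMSEQ_Suc[OF lim_1_over_n]] by simp
      show "\<exists>N. \<forall>n\<ge>N. 0 \<le> 2 * t * (energy (gradient (\<phi> n)) (gradient \<psi>) - F \<psi>) + t\<^sup>2 * E + 1 / real (Suc n)"
      proof (intro exI[of _ 0] allI impI)
        fix n
        have "I \<le> J (\<lambda>x. \<phi> n x + t * \<psi> x)" by (intro I test_fun_add test_fun_cmult \<phi> \<psi>)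
        then show "0 \<le> 2 * t * (energy (gradient (\<phi> n)) (gradient \<psi>) - F \<psi>) + t\<^sup>2 * E + 1 / real (Suc n)"
          using J\<phi>[of n] unfolding J_add[OF \<phi>[of n] \<psi>] E_def by linarith
      qed
    qed
    \<comment> \<open>For positive \<open>E\<close> the quadratic is minimal at
      \<open>- L / E\<close>; the denominator \<open>E + 1\<close> also covers \<open>E = 0\<close>
      and still yields a negative value unless \<open>L\<close> vanishes.\<close>
    define s where "s = L / (E + 1)"
    have L: "L = s * (E + 1)" using E by (simp add: s_def)
    have "2 * (- s) * L + (- s)\<^sup>2 * E = - (s\<^sup>2 * (E + 2))"
      unfolding L by (simp add: power2_eq_square algebra_simps)
    with quadratic[of "- s"] have "s\<^sup>2 * (E + 2) \<le> 0" by linarith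
    then have "s\<^sup>2 \<le> 0" using E by (simp add: mult_le_0_iff)
    then have "s = 0" by simp
    then have "L = 0" unfolding L by simp
    then show ?thesis by (simp add: L_def)
  qed
  have "solves g"
    unfolding solves_def
  proof (intro allI impI)
    fix v h assume "H0_pair \<Omega> v h"
    then obtain \<psi> where v: "square_integrable M v" and h: "square_integrable M h" and \<psi>: "\<And>n. test_fun \<Omega> (\<psi> n)"
      and lim: "(\<lambda>n. LINT x|M. (norm (\<psi> n x - v x))\<^sup>2) \<longlonglongrightarrow> 0"
        "(\<lambda>n. LINT x|M. (norm (gradient (\<psi> n) x - h x))\<^sup>2) \<longlonglongrightarrow> 0"
      unfolding H0_pair_def by blast
    \<comment> \<open>Both sides of the equation are continuous along approximating test functions,
      so it extends from these to all pairs.\<close>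
    have "(\<lambda>n. energy g (gradient (\<psi> n))) \<longlonglongrightarrow> energy g h"
      unfolding energy_def by (intro tendsto_integral_inner square_integrable_\<alpha> sq \<psi> g h lim)
    moreover have "(\<lambda>n. F (\<psi> n)) \<longlonglongrightarrow> (LINT x|M. f x * v x)"
      using tendsto_integral_inner[OF square_integrable_f sq(1)[OF \<psi>] v lim(1)] unfolding F_def by simp
    ultimately show "energy g h = (LINT x|M. f x * v x)"
      unfolding test[OF \<psi>] by (rule LIMSEQ_unique)
  qed
  with pair show ?thesis by blast
qed

end

section \<open>The Kirchhoff transform and the quasilinear problem\<close>

text \<open>A slope of at least \<open>b0\<close> makes \<open>B\<close> strictly increasing and
  forces at least linear growth in both directions, hence a bijection of the line. Its inverse is
  continuous, and differentiable because the slope never vanishes.\<close>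

lemma Kirchhoff_transform:
  fixes b :: "real \<Rightarrow> real"
  assumes b: "continuous_on UNIV b" and b0: "0 < b0" "\<And>t. b0 \<le> b t"
  obtains B C where "\<And>t. (B has_real_derivative b t) (at t)" "B 0 = 0"
    "\<And>t. (C has_real_derivative 1 / b (C t)) (at t)" "C 0 = 0"
    "\<And>t. C (B t) = t" "\<And>t. B (C t) = t"
proof -
  have "\<exists>F. \<forall>x::real. -\<infinity> < ereal x \<longrightarrow> ereal x < \<infinity> \<longrightarrow> (F has_vector_derivative b x) (at x)"
    using b by (intro einterval_antiderivative) (auto simp: continuous_on_eq_continuous_at)
  then obtain F where F: "\<And>t. (F has_real_derivative b t) (at t)"
    by (auto simp: has_real_derivative_iff_has_vector_derivative)
  define B where "B t = F t - F 0" for t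
  have B: "(B has_real_derivative b t) (at t)" for t
    unfolding B_def using F by (auto intro!: derivative_eq_intros)
  have B0: "B 0 = 0" by (simp add: B_def)
  have bpos: "b t > 0" for t using b0(1) b0(2)[of t] by linarith
  have mono: "B s < B t" if "s < t" for s t
    using that by (rule DERIV_pos_imp_increasing) (use B bpos in blast)
  have inj: "inj B" by (rule injI) (metis mono linorder_neqE less_irrefl)
  have grow: "b0 * (t - s) \<le> B t - B s" if st: "s \<le> t" for s t
  proof -
    have "B s - b0 * s \<le> B t - b0 * t"
      by (rule DERIV_nonneg_imp_nondecreasing[OF st])
        (use b0(2) in \<open>auto intro!: exI derivative_eq_intros B\<close>)
    then show ?thesis by (simp add: algebra_simps)
  qed
  have cont: "isCont B t" for t using B by (rule DERIV_isCont)
  have surj: "\<exists>t. B t = y" for y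
  proof (cases "y \<ge> 0")
    case True
    \<comment> \<open>The point \<open>y / b0\<close> is where the linear lower bound reaches
      \<open>y\<close>, so \<open>B\<close> has passed \<open>y\<close> by then; for negative
      \<open>y\<close> it plays the mirrored role.\<close>
    have "B 0 \<le> y" "y \<le> B (y / b0)" "0 \<le> y / b0"
      using grow[of 0 "y / b0"] True b0(1) B0 by auto
    from IVT[OF this] cont show ?thesis by auto
  next
    case False
    have "B (y / b0) \<le> y" "y \<le> B 0" "y / b0 \<le> 0"
      using grow[of "y / b0" 0] False b0(1) B0 by (auto simp: divide_le_0_iff)
    from IVT[OF this] cont show ?thesis by auto
  qed
  define C where "C = inv B"
  have CB: "C (B t) = t" for t unfolding C_def by (rule inv_f_f[OF inj])
  have BC: "B (C t) = t" for t unfolding C_def by (rule f_inv_into_f) (use surj[of t] in auto)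
  have "isCont C t" for t
    using isCont_inverse_function[of 1 "C t" C B] CB BC cont by simp
  then have "(C has_real_derivative inverse (b (C t))) (at t)" for t
    by (intro DERIV_inverse_function[where f=B and a="t - 1" and b="t + 1"])
      (use B BC bpos in \<open>auto simp: less_imp_neq[symmetric]\<close>)
  moreover have "C 0 = 0" using CB[of 0] B0 by simp
  ultimately show thesis using that[of B C] B B0 CB BC by (simp add: inverse_eq_divide)
qed

text \<open>The set where the essential bound holds is closed by continuity, and a closed set of
  full measure is everything. The chain rule needs the bound at every point, as \<open>u\<close> may
  take its values in a null set.\<close>

lemma continuous_Linf_bounded:
  fixes b :: "real \<Rightarrow> real"
  assumes "continuous_on UNIV b" "b \<in> Linf UNIV"
  obtains C where "\<And>t. \<bar>b t\<bar> \<le> C"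
proof -
  obtain C where "AE x in lebesgue_on UNIV. \<bar>b x\<bar> \<le> C"
    using assms(2) unfolding Linf_def by blast
  then have "AE x in lebesgue. x \<in> {x. \<bar>b x\<bar> \<le> C}"
    unfolding lebesgue_on_UNIV_eq by simp
  moreover have "closed {x. \<bar>b x\<bar> \<le> C}"
    using assms(1) by (intro closed_Collect_le continuous_intros)
  ultimately have "\<bar>b t\<bar> \<le> C" for t
    using mem_closed_if_AE_lebesgue[of "{x. \<bar>b x\<bar> \<le> C}" t] by simp
  then show ?thesis by (rule that)
qed

theorem theorem3p2:
  fixes \<Omega> :: "(real^2) set" and \<alpha> :: "real^2 \<Rightarrow> real" and b :: "real \<Rightarrow> real"
    and \<alpha>0 \<alpha>1 b0 :: real and f :: "real^2 \<Rightarrow> real"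
  assumes "bounded \<Omega>" and "polygonal_domain \<Omega>"
    and "\<alpha> \<in> borel_measurable (lebesgue_on \<Omega>)"
    and "0 < \<alpha>0" and "AE x in lebesgue_on \<Omega>. \<alpha>0 \<le> \<alpha> x \<and> \<alpha> x \<le> \<alpha>1"
    and "continuous_on UNIV b" and "b \<in> W2inf UNIV"
    and "0 < b0" and "\<And>t. b0 \<le> b t"
    and "f \<in> L2 \<Omega>"
  shows "\<exists>u. weak_solution \<Omega> \<alpha> b f u \<and>
           (\<forall>w. weak_solution \<Omega> \<alpha> b f w \<longrightarrow> (AE x in lebesgue_on \<Omega>. w x = u x))"
proof -
  interpret elliptic \<Omega> \<alpha> f \<alpha>0 \<alpha>1
    using assms(1-5,10) by unfold_locales (auto simp: polygonal_domain_def L2_iff_square_integrable)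
  obtain B C where B: "\<And>t. (B has_real_derivative b t) (at t)" "B 0 = 0"
    and C: "\<And>t. (C has_real_derivative 1 / b (C t)) (at t)" "C 0 = 0"
    and CB: "\<And>t. C (B t) = t" and BC: "\<And>t. B (C t) = t"
    using Kirchhoff_transform[OF assms(6,8,9)] by blast
  obtain b1 where b1: "\<And>t. \<bar>b t\<bar> \<le> b1"
    using continuous_Linf_bounded[OF assms(6)] assms(7) by (auto simp: W2inf_def)
  have bpos: "b t > 0" for t using assms(8) assms(9)[of t] by linarith
  have pairB: "H0_pair \<Omega> (\<lambda>x. B (u x)) (\<lambda>x. b (u x) *\<^sub>R weak_grad \<Omega> u x)" if "u \<in> H10 \<Omega>" for u
    by (rule H0_pair_compose[OF H10_imp_H0_pair[OF that] B assms(6) b1])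
  \<comment> \<open>The equation for \<open>u\<close> involves its gradient only through the field
    \<open>b(u)\<close> times \<open>weak_grad\<close>, which by \<open>pairB\<close> is the
    gradient of the transform of \<open>u\<close>. What remains is to pass between test elements of
    \<open>H10\<close> and pairs.\<close>
  have iff: "weak_solution \<Omega> \<alpha> b f u \<longleftrightarrow> u \<in> H10 \<Omega> \<and> solves (\<lambda>x. b (u x) *\<^sub>R weak_grad \<Omega> u x)" for u
  proof (cases "u \<in> H10 \<Omega>")
    case True
    let ?g = "\<lambda>x. b (u x) *\<^sub>R weak_grad \<Omega> u x"
    have g: "square_integrable M ?g" using pairB[OF True] by (simp add: H0_pair_def)
    have eq: "(LINT x|lebesgue_on \<Omega>. \<alpha> x * b (u x) * (weak_grad \<Omega> u x \<bullet> weak_grad \<Omega> v x)) = energy ?g (weak_grad \<Omega> v)" for v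
      by (simp add: energy_def mult.assoc)
    have key: "energy ?g h = energy ?g (weak_grad \<Omega> v)" if vh: "H0_pair \<Omega> v h" for v h
    proof (rule energy_cong_AE)
      note H = H0_pair_imp_H10[OF vh]
      show "square_integrable M h" "square_integrable M (weak_grad \<Omega> v)"
        using vh H10_imp_H0_pair[OF H(1)] by (auto simp: H0_pair_def)
      show "AE x in M. h x = weak_grad \<Omega> v x" using H(2) by eventually_elim simp
    qed (use g in auto)
    have "solves ?g \<longleftrightarrow> (\<forall>v\<in>H10 \<Omega>. energy ?g (weak_grad \<Omega> v) = (LINT x|M. f x * v x))"
    proof
      assume "solves ?g"
      then show "\<forall>v\<in>H10 \<Omega>. energy ?g (weak_grad \<Omega> v) = (LINT x|M. f x * v x)"
        unfolding solves_def using H10_imp_H0_pair by blast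
    next
      assume *: "\<forall>v\<in>H10 \<Omega>. energy ?g (weak_grad \<Omega> v) = (LINT x|M. f x * v x)"
      show "solves ?g"
        unfolding solves_def
      proof (intro allI impI)
        fix v h assume vh: "H0_pair \<Omega> v h"
        show "energy ?g h = (LINT x|M. f x * v x)"
          using key[OF vh] * H0_pair_imp_H10(1)[OF vh] by simp
      qed
    qed
    then show ?thesis
      unfolding weak_solution_def eq using True by blast
  qed (simp add: weak_solution_def)
  obtain w g where wg: "H0_pair \<Omega> w g" "solves g" using solves_exists by blast
  have "continuous_on UNIV C" using DERIV_isCont[OF C(1)] by (simp add: continuous_on_eq_continuous_at)
  then have "continuous_on UNIV (\<lambda>t. 1 / b (C t))"
    by (intro continuous_intros continuous_on_compose2[OF assms(6)]) (use bpos in \<open>auto simp: less_imp_neq[symmetric]\<close>)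
  \<comment> \<open>Here the lower bound on \<open>b\<close> enters as the bound on the derivative
    of the inverse transform.\<close>
  moreover have "\<bar>1 / b (C t)\<bar> \<le> 1 / b0" for t
    using assms(8,9) bpos[of "C t"] by (simp add: frac_le)
  ultimately have u: "H0_pair \<Omega> (\<lambda>x. C (w x)) (\<lambda>x. (1 / b (C (w x))) *\<^sub>R g x)"
    by (rule H0_pair_compose[OF wg(1) C])
  define u where "u = (\<lambda>x. C (w x))"
  note uH = H0_pair_imp_H10[OF u, folded u_def]
  \<comment> \<open>The factor \<open>b(u)\<close> cancels the factor \<open>1 / b (C (w x))\<close>
    of the chain rule, so the weighted gradient of \<open>u\<close> is the field that solves the
    linear problem.\<close>
  have "AE x in M. g x = b (u x) *\<^sub>R weak_grad \<Omega> u x"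
    using uH(2) by eventually_elim (use bpos in \<open>simp add: u_def less_imp_neq[symmetric]\<close>)
  moreover have "square_integrable M g" "square_integrable M (\<lambda>x. b (u x) *\<^sub>R weak_grad \<Omega> u x)"
    using wg(1) pairB[OF uH(1)] by (auto simp: H0_pair_def)
  ultimately have "energy g h = energy (\<lambda>x. b (u x) *\<^sub>R weak_grad \<Omega> u x) h" if "H0_pair \<Omega> v h" for v h
    using that by (intro energy_cong_AE) (auto simp: H0_pair_def)
  then have u_solves: "solves (\<lambda>x. b (u x) *\<^sub>R weak_grad \<Omega> u x)"
    using wg(2) unfolding solves_def by auto
  show ?thesis
  proof (intro exI[of _ u] conjI allI impI)
    show "weak_solution \<Omega> \<alpha> b f u" using iff uH(1) u_solves by blast
    fix v assume "weak_solution \<Omega> \<alpha> b f v"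
    then have v: "v \<in> H10 \<Omega>" "solves (\<lambda>x. b (v x) *\<^sub>R weak_grad \<Omega> v x)" using iff by auto
    \<comment> \<open>The transforms of both solutions solve the same linear problem; applying
      \<open>C\<close> afterwards recovers the solutions themselves.\<close>
    have "AE x in M. B (v x) = B (u x)"
      by (rule solves_unique[OF pairB[OF v(1)] v(2) pairB[OF uH(1)] u_solves])
    then show "AE x in lebesgue_on \<Omega>. v x = u x"
      by eventually_elim (metis CB)
  qed
qed

end
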